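(* Let $\Omega$ be an aperiodic, repetitive tiling space of $\mathbb{R}^d$ with finite local complexity, and suppose that $\Omega$ has polynomial complexity function with exponent $\alpha$, meaning that for some canonical transversal $\Xi$ of $\Omega$ (and hence for all) there are two constants $C_1,C_2>0$ such that for all $r$ big enough, $$C_1 r^\alpha\le p_\Xi(r)\le C_2 r^\alpha .$$ Then $\alpha$ is a homeomorphism invariant of the space: any aperiodic repetitive tiling space of $\mathbb{R}^d$ with finite local complexity which is homeomorphic to $\Omega$ has polynomial complexity function with the same exponent $\alpha$.
   Context: Tilings. A tile is a compact subset of $\mathbb{R}^d$ homeomorphic to a closed ball and equal to the closure of its interior (possibly decorated with a label); a prototile is an equivalence class of tiles under translation. For each tiling space a finite collection of prototiles is fixed. A tiling is a collection $T=\{t_i\}_{i\in I}$ of tiles whose translation classes are in this collection, whose union is $\mathbb{R}^d$, and such that $t_i\cap t_j$ has empty interior for $i\neq j$. For $x\in\mathbb{R}^d$, $T-x=\{t_i-x\}_{i\in I}$ (tilings are not identified with their translates). $B(x,r)$ is the ball of centre $x$ and radius $r$, and $T\cap B(x,r)$ denotes the patch of all tiles of $T$ which intersect $B(x,r)$. $T$ is aperiodic if $T-x\neq T$ for all $x\neq 0$; $T$ has finite local complexity (FLC) if for all $R>0$ there are finitely many patches $T\cap B(x,R)$, $x\in\mathbb{R}^d$, up to translation; $T$ is repetitive if for every finite patch $P\subset T$ there is $R>0$ such that a translate of $P$ appears in $T\cap B(x,R)$ for every $x\in\mathbb{R}^d$. Tiling spaces. Define a distance on tilings with the given prototiles by letting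 $D(T_1,T_2)$ be the minimum of $1/\sqrt2$ and the infimum of all $\varepsilon>0$ for which there are $x_1,x_2\in\mathbb{R}^d$ with $\|x_i\|\le\varepsilon$ such that $T_1-x_1$ and $T_2-x_2$ agree on $B(0,1/\varepsilon)$. The hull (tiling space) of $T$ is the closure $\Omega=\overline{\{T-x : x\in\mathbb{R}^d\}}$ for $D$; $\mathbb{R}^d$ acts continuously on it by translation. An aperiodic repetitive tiling space with FLC is the hull of an aperiodic, repetitive tiling with FLC. Transversals. A Delaunay set is a uniformly discrete and relatively dense subset of $\mathbb{R}^d$. A local pointing rule on $\Omega$ is a map $\mathcal{D}$ assigning to each $T\in\Omega$ a Delaunay set $\mathcal{D}(T)$, commuting with translations ($\mathcal{D}(T-x)=\mathcal{D}(T)-x$), and local: there are $\rho,R>0$ such that for all $T\in\Omega$, $\mathcal{D}(T)\cap B(0,\rho)$ only depends on $T\cap B(0,R)$. The canonical transversal associated with $\mathcal{D}$ is $\Xi_{\mathcal{D}}=\{T\in\Omega : 0\in\mathcal{D}(T)\}$. Complexity. For a canonical transversal $\Xi$, the complexity function is $p_\Xi(r)=\mathrm{Card}\{T\cap B(0,r) : T\in\Xi\}$. *)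

theory Defs
  imports "HOL-Analysis.Analysis"
begin

text \<open>
  A tile is a pair of its support and its label; undecorated tiles are those with label
  type \<^typ>\<open>unit\<close>. Euclidean space \<open>\<real>\<^sup>d\<close> is a type \<open>'a\<close> of class \<^class>\<open>euclidean_space\<close>
  with \<open>DIM('a) = d\<close>.
\<close>

type_synonym ('a, 'l) tile = "'a set \<times> 'l"
type_synonym ('a, 'l) tiling = "('a, 'l) tile set"

definition is_tile :: "('a::euclidean_space, 'l) tile \<Rightarrow> bool" where
  "is_tile t \<longleftrightarrow> compact (fst t) \<and> fst t homeomorphic (cball 0 1 :: 'a set) \<and>
     closure (interior (fst t)) = fst t"

text \<open>The translates \<open>t - x\<close> and \<open>T - x\<close>; translation does not change labels.\<close>

definition tile_minus :: "('a::euclidean_space, 'l) tile \<Rightarrow> 'a \<Rightarrow> ('a, 'l) tile" where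
  "tile_minus t x = ((\<lambda>y. y - x) ` fst t, snd t)"

definition tiling_minus :: "('a::euclidean_space, 'l) tiling \<Rightarrow> 'a \<Rightarrow> ('a, 'l) tiling" where
  "tiling_minus T x = (\<lambda>t. tile_minus t x) ` T"

definition prototile :: "('a::euclidean_space, 'l) tile set \<Rightarrow> bool" where
  "prototile p \<longleftrightarrow> (\<exists>t. is_tile t \<and> p = range (tile_minus t))"

text \<open>
  A tiling is a set of tiles rather than an indexed family: tiles have nonempty interior, so the
  condition on overlaps excludes repetitions.
\<close>

definition tiling :: "('a::euclidean_space, 'l) tile set set \<Rightarrow> ('a, 'l) tiling \<Rightarrow> bool" where
  "tiling Pr T \<longleftrightarrow> T \<subseteq> \<Union>Pr \<and> (\<Union>t\<in>T. fst t) = UNIV \<and>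
     pairwise (\<lambda>s t. interior (fst s \<inter> fst t) = {}) T"

text \<open>
  The patch \<open>T \<inter> B(x,r)\<close> consists of whole tiles, those which meet the ball.
\<close>

definition patch :: "('a::euclidean_space, 'l) tiling \<Rightarrow> 'a \<Rightarrow> real \<Rightarrow> ('a, 'l) tiling" where
  "patch T x r = {t \<in> T. fst t \<inter> ball x r \<noteq> {}}"

definition aperiodic :: "('a::euclidean_space, 'l) tiling \<Rightarrow> bool" where
  "aperiodic T \<longleftrightarrow> (\<forall>x. x \<noteq> 0 \<longrightarrow> tiling_minus T x \<noteq> T)"

text \<open>\<open>range (tiling_minus P)\<close> is the translation class of the patch \<open>P\<close>.\<close>

definition finite_local_complexity :: "('a::euclidean_space, 'l) tiling \<Rightarrow> bool" where
  "finite_local_complexity T \<longleftrightarrow>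
     (\<forall>R>0. finite {range (tiling_minus (patch T x R)) | x. x \<in> UNIV})"

definition repetitive :: "('a::euclidean_space, 'l) tiling \<Rightarrow> bool" where
  "repetitive T \<longleftrightarrow>
     (\<forall>P. finite P \<and> P \<subseteq> T \<longrightarrow> (\<exists>R>0. \<forall>x. \<exists>y. tiling_minus P y \<subseteq> patch T x R))"

definition tilings_agree :: "('a::euclidean_space, 'l) tiling \<Rightarrow> ('a, 'l) tiling \<Rightarrow> real \<Rightarrow> bool" where
  "tilings_agree T\<^sub>1 T\<^sub>2 \<epsilon> \<longleftrightarrow> (\<exists>x\<^sub>1 x\<^sub>2. norm x\<^sub>1 \<le> \<epsilon> \<and> norm x\<^sub>2 \<le> \<epsilon> \<and>
     patch (tiling_minus T\<^sub>1 x\<^sub>1) 0 (1 / \<epsilon>) = patch (tiling_minus T\<^sub>2 x\<^sub>2) 0 (1 / \<epsilon>))"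

text \<open>
  The infimum of the set with \<open>1 / sqrt 2\<close> inserted is the minimum of \<open>1 / sqrt 2\<close> and the
  infimum of the set, where the infimum of the empty set is read as \<open>\<infinity>\<close>; this matters, since
  \<open>tilings_agree\<close> may fail for every \<open>\<epsilon>\<close>, and \<open>Inf {}\<close> is unspecified for the reals.
\<close>

definition tiling_dist :: "('a::euclidean_space, 'l) tiling \<Rightarrow> ('a, 'l) tiling \<Rightarrow> real" where
  "tiling_dist T\<^sub>1 T\<^sub>2 = Inf (insert (1 / sqrt 2) {\<epsilon>. \<epsilon> > 0 \<and> tilings_agree T\<^sub>1 T\<^sub>2 \<epsilon>})"

text \<open>
  The terms \<^const>\<open>Metric_space.mtopology\<close> below are meaningful by the lemma
  \<open>Metric_space_tilings\<close> proved at the end of this theory.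
\<close>

definition tiling_hull :: "('a::euclidean_space, 'l) tile set set \<Rightarrow> ('a, 'l) tiling \<Rightarrow> ('a, 'l) tiling set" where
  "tiling_hull Pr T = Metric_space.mtopology {T'. tiling Pr T'} tiling_dist closure_of (range (tiling_minus T))"

definition space_topology :: "('a::euclidean_space, 'l) tiling set \<Rightarrow> ('a, 'l) tiling topology" where
  "space_topology \<Omega> = Metric_space.mtopology \<Omega> tiling_dist"

definition aperiodic_repetitive_FLC_space :: "('a::euclidean_space, 'l) tiling set \<Rightarrow> bool" where
  "aperiodic_repetitive_FLC_space \<Omega> \<longleftrightarrow>
     (\<exists>Pr T. finite Pr \<and> (\<forall>p\<in>Pr. prototile p) \<and> tiling Pr T \<and>
       aperiodic T \<and> repetitive T \<and> finite_local_complexity T \<and> \<Omega> = tiling_hull Pr T)"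

definition uniformly_discrete :: "'a::euclidean_space set \<Rightarrow> bool" where
  "uniformly_discrete X \<longleftrightarrow> (\<exists>r>0. \<forall>x\<in>X. \<forall>y\<in>X. x \<noteq> y \<longrightarrow> r \<le> dist x y)"

definition relatively_dense :: "'a::euclidean_space set \<Rightarrow> bool" where
  "relatively_dense X \<longleftrightarrow> (\<exists>R>0. \<forall>x. \<exists>y\<in>X. dist x y \<le> R)"

definition Delaunay :: "'a::euclidean_space set \<Rightarrow> bool" where
  "Delaunay X \<longleftrightarrow> uniformly_discrete X \<and> relatively_dense X"

definition local_pointing_rule ::
    "('a::euclidean_space, 'l) tiling set \<Rightarrow> (('a, 'l) tiling \<Rightarrow> 'a set) \<Rightarrow> bool" where
  "local_pointing_rule \<Omega> \<D> \<longleftrightarrow>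
     (\<forall>T\<in>\<Omega>. Delaunay (\<D> T)) \<and>
     (\<forall>T\<in>\<Omega>. \<forall>x. \<D> (tiling_minus T x) = (\<lambda>y. y - x) ` \<D> T) \<and>
     (\<exists>\<rho>>0. \<exists>R>0. \<forall>T\<in>\<Omega>. \<forall>T'\<in>\<Omega>.
        patch T 0 R = patch T' 0 R \<longrightarrow> \<D> T \<inter> ball 0 \<rho> = \<D> T' \<inter> ball 0 \<rho>)"

definition canonical_transversal ::
    "('a::euclidean_space, 'l) tiling set \<Rightarrow> (('a, 'l) tiling \<Rightarrow> 'a set) \<Rightarrow> ('a, 'l) tiling set" where
  "canonical_transversal \<Omega> \<D> = {T \<in> \<Omega>. 0 \<in> \<D> T}"

definition complexity :: "('a::euclidean_space, 'l) tiling set \<Rightarrow> real \<Rightarrow> nat" where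
  "complexity \<Xi> r = card {patch T 0 r | T. T \<in> \<Xi>}"

text \<open>
  Since \<^const>\<open>card\<close> is \<open>0\<close> on infinite sets, the lower bound here, when applied to
  \<^const>\<open>complexity\<close>, also says that the sets of patches are finite for large \<open>r\<close>.
\<close>

definition polynomial_growth :: "(real \<Rightarrow> nat) \<Rightarrow> real \<Rightarrow> bool" where
  "polynomial_growth p \<alpha> \<longleftrightarrow> (\<exists>C\<^sub>1>0. \<exists>C\<^sub>2>0. \<forall>\<^sub>F r in at_top.
     C\<^sub>1 * r powr \<alpha> \<le> real (p r) \<and> real (p r) \<le> C\<^sub>2 * r powr \<alpha>)"

definition polynomial_complexity :: "('a::euclidean_space, 'l) tiling set \<Rightarrow> real \<Rightarrow> bool" where
  "polynomial_complexity \<Omega> \<alpha> \<longleftrightarrow>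
     (\<exists>\<D>. local_pointing_rule \<Omega> \<D> \<and> polynomial_growth (complexity (canonical_transversal \<Omega> \<D>)) \<alpha>)"


lemma tile_minus_0 [simp]: "tile_minus t 0 = t"
  by (simp add: tile_minus_def)

lemma tile_minus_minus: "tile_minus (tile_minus t x) y = tile_minus t (x + y)"
  by (simp add: tile_minus_def image_image algebra_simps)

lemma tiling_minus_0 [simp]: "tiling_minus T 0 = T"
  by (simp add: tiling_minus_def)

lemma tiling_minus_minus: "tiling_minus (tiling_minus T x) y = tiling_minus T (x + y)"
  by (simp add: tiling_minus_def image_image tile_minus_minus)

lemma tile_minus_meets_ball:
  "fst (tile_minus t x) \<inter> ball z r = {} \<longleftrightarrow> fst t \<inter> ball (z + x) r = {}"
proof -
  have "dist z (y - x) = dist (z + x) y" for y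
    by (simp add: dist_norm algebra_simps)
  then show ?thesis
    by (auto simp: tile_minus_def ball_def)
qed

lemma patch_tiling_minus: "patch (tiling_minus T x) z r = tiling_minus (patch T (z + x) r) x"
  unfolding patch_def tiling_minus_def using tile_minus_meets_ball by blast

lemma patch_eq_subball:
  assumes "patch A x r = patch B x r" "ball z s \<subseteq> ball x r"
  shows "patch A z s = patch B z s"
proof -
  have "patch C z s = {t \<in> patch C x r. fst t \<inter> ball z s \<noteq> {}}" for C :: "('a, 'b) tiling"
    using assms(2) by (auto simp: patch_def)
  from this[of A] this[of B] show ?thesis using assms(1) by (simp only:)
qed

lemma tilings_agree_commute: "tilings_agree A B \<epsilon> \<longleftrightarrow> tilings_agree B A \<epsilon>"
  unfolding tilings_agree_def by metis

lemma tilings_agree_refl: "\<epsilon> > 0 \<Longrightarrow> tilings_agree A A \<epsilon>"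
  unfolding tilings_agree_def by (intro exI[of _ 0]) simp

lemma tiling_dist_bdd: "bdd_below (insert (1 / sqrt 2) {\<epsilon>. \<epsilon> > 0 \<and> tilings_agree A B \<epsilon>})"
  by (rule bdd_belowI[of _ 0]) auto

lemma tiling_dist_nonneg: "0 \<le> tiling_dist A B"
  unfolding tiling_dist_def by (rule cInf_greatest) auto

lemma tiling_dist_le: "\<epsilon> > 0 \<Longrightarrow> tilings_agree A B \<epsilon> \<Longrightarrow> tiling_dist A B \<le> \<epsilon>"
  unfolding tiling_dist_def by (rule cInf_lower[OF _ tiling_dist_bdd]) auto

lemma tiling_dist_le_max: "tiling_dist A B \<le> 1 / sqrt 2"
  unfolding tiling_dist_def by (rule cInf_lower[OF _ tiling_dist_bdd]) auto

lemma tiling_dist_lessD: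
  assumes "tiling_dist A B < e" "e \<le> 1 / sqrt 2"
  obtains \<epsilon> where "0 < \<epsilon>" "\<epsilon> < e" "tilings_agree A B \<epsilon>"
proof -
  obtain \<epsilon> where "\<epsilon> \<in> insert (1 / sqrt 2) {\<epsilon>. \<epsilon> > 0 \<and> tilings_agree A B \<epsilon>}" "\<epsilon> < e"
    using cInf_lessD[of "insert (1 / sqrt 2) {\<epsilon>. \<epsilon> > 0 \<and> tilings_agree A B \<epsilon>}" e] assms(1)
    unfolding tiling_dist_def by auto
  then show ?thesis using that assms(2) by auto
qed

lemma tilings_agree_trans:
  assumes "tilings_agree A B a" "tilings_agree B C b"
    and "0 < a" "a \<le> 1 / sqrt 2" "0 < b" "b \<le> 1 / sqrt 2"
  shows "tilings_agree A C (a + b)"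
proof -
  have bound: "1 / (u + v) + v \<le> 1 / u" if "0 < u" "u \<le> 1 / sqrt 2" "0 < v" "v \<le> 1 / sqrt 2"
    for u v :: real
  proof -
    have "u * (u + v) \<le> (1 / sqrt 2) * (1 / sqrt 2 + 1 / sqrt 2)"
      using that by (intro mult_mono) auto
    also have "\<dots> = 1" by (simp add: field_simps)
    finally have "v * (u * (u + v)) \<le> v" using that by (simp add: mult_left_le)
    then show ?thesis using that by (simp add: field_simps)
  qed
  obtain x y where xy: "norm x \<le> a" "norm y \<le> a"
    "patch (tiling_minus A x) 0 (1/a) = patch (tiling_minus B y) 0 (1/a)"
    using assms(1) unfolding tilings_agree_def by auto
  obtain z w where zw: "norm z \<le> b" "norm w \<le> b"
    "patch (tiling_minus B z) 0 (1/b) = patch (tiling_minus C w) 0 (1/b)"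
    using assms(2) unfolding tilings_agree_def by auto
  let ?r = "1 / (a + b)"
  have "ball z ?r \<subseteq> ball 0 (1/a)"
    using bound[of a b] assms zw by (intro ball_subset_ball_iff[THEN iffD2]) (auto simp: dist_norm)
  then have 1: "patch (tiling_minus A x) z ?r = patch (tiling_minus B y) z ?r"
    using patch_eq_subball[OF xy(3)] by blast
  have "ball y ?r \<subseteq> ball 0 (1/b)"
    using bound[of b a] assms xy by (intro ball_subset_ball_iff[THEN iffD2])
      (auto simp: dist_norm add.commute)
  then have 2: "patch (tiling_minus B z) y ?r = patch (tiling_minus C w) y ?r"
    using patch_eq_subball[OF zw(3)] by blast
  have shift: "patch (tiling_minus T (u + v)) 0 s = tiling_minus (patch (tiling_minus T u) v s) v"
    for T :: "('a, 'b) tiling" and u v s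
    by (metis add_0 patch_tiling_minus tiling_minus_minus)
  have 3: "patch (tiling_minus A (x + z)) 0 ?r = patch (tiling_minus C (w + y)) 0 ?r"
  proof -
    have "patch (tiling_minus A (x + z)) 0 ?r = patch (tiling_minus B (y + z)) 0 ?r"
      unfolding shift 1 ..
    also have "\<dots> = patch (tiling_minus B (z + y)) 0 ?r"
      by (rule arg_cong[OF add.commute])
    also have "\<dots> = patch (tiling_minus C (w + y)) 0 ?r"
      unfolding shift 2 ..
    finally show ?thesis .
  qed
  have "norm (x + z) \<le> a + b" "norm (w + y) \<le> a + b"
    using xy zw norm_triangle_ineq[of x z] norm_triangle_ineq[of w y] by linarith+
  then show ?thesis
    unfolding tilings_agree_def using 3 by blast
qed

lemma tiling_dist_triangle: "tiling_dist A C \<le> tiling_dist A B + tiling_dist B C"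
proof (rule ccontr)
  assume "\<not> ?thesis"
  then have lt: "tiling_dist A B + tiling_dist B C < tiling_dist A C" by simp
  define d where "d = (tiling_dist A C - tiling_dist A B - tiling_dist B C) / 2"
  have d: "d > 0" using lt by (simp add: d_def)
  have d2: "2 * d = tiling_dist A C - tiling_dist A B - tiling_dist B C" by (simp add: d_def)
  have m: "tiling_dist A C \<le> 1 / sqrt 2" by (rule tiling_dist_le_max)
  have n: "0 \<le> tiling_dist A B" "0 \<le> tiling_dist B C" by (rule tiling_dist_nonneg)+
  have l1: "tiling_dist A B + d \<le> 1 / sqrt 2" "tiling_dist B C + d \<le> 1 / sqrt 2"
    using m n d d2 by linarith+
  obtain a where a: "0 < a" "a < tiling_dist A B + d" "tilings_agree A B a"
    using tiling_dist_lessD[of A B "tiling_dist A B + d"] l1 d by auto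
  obtain b where b: "0 < b" "b < tiling_dist B C + d" "tilings_agree B C b"
    using tiling_dist_lessD[of B C "tiling_dist B C + d"] l1 d by auto
  have "tilings_agree A C (a + b)"
    using tilings_agree_trans[OF a(3) b(3)] a b l1 by linarith
  then have "tiling_dist A C \<le> a + b" using a b by (intro tiling_dist_le) auto
  then show False using a b d2 by linarith
qed

lemma compact_translate_eqD:
  fixes S :: "'a::euclidean_space set"
  assumes "compact S" "S \<noteq> {}" "(\<lambda>p. p - y) ` S = (\<lambda>p. p - z) ` S"
  shows "y = z"
proof (rule ccontr)
  assume "y \<noteq> z"
  have "continuous_on S (\<lambda>p. (z - y) \<bullet> p)" by (intro continuous_intros)
  from continuous_attains_sup[OF assms(1,2) this]
  obtain p where p: "p \<in> S" "\<And>q. q \<in> S \<Longrightarrow> (z - y) \<bullet> q \<le> (z - y) \<bullet> p" by auto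
  obtain q where q: "q \<in> S" "p - y = q - z" using p(1) assms(3) by blast
  have "q = p + (z - y)" using q(2) by (simp add: algebra_simps)
  then have "(z - y) \<bullet> q = (z - y) \<bullet> p + (z - y) \<bullet> (z - y)" by (simp add: inner_add_right)
  moreover have "(z - y) \<bullet> (z - y) > 0" using \<open>y \<noteq> z\<close> by simp
  ultimately show False using p(2)[OF q(1)] by linarith
qed

lemma prototile_tile:
  assumes "\<forall>p\<in>Pr. prototile p" "tiling Pr T" "t \<in> T"
  obtains c r where "r > 0" "ball c r \<subseteq> fst t" "compact (fst t)"
proof -
  have "t \<in> \<Union>Pr" using assms(2,3) by (auto simp: tiling_def)
  then obtain p where "p \<in> Pr" "t \<in> p" by auto
  then obtain s where s: "is_tile s" "t \<in> range (tile_minus s)"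
    using assms(1) by (auto simp: prototile_def)
  then obtain x where x: "t = tile_minus s x" by auto
  have "fst s \<noteq> {}" using s(1) homeomorphic_empty(1)[of "cball 0 1 :: 'a set"]
    unfolding is_tile_def by auto
  then have "interior (fst s) \<noteq> {}" using s(1) unfolding is_tile_def by force
  then obtain c r where cr: "r > 0" "ball c r \<subseteq> fst s" by (meson ex_in_conv mem_interior)
  have "ball (c - x) r \<subseteq> fst t"
  proof
    fix y assume "y \<in> ball (c - x) r"
    then have "y + x \<in> ball c r" by (simp add: dist_norm algebra_simps)
    then have "y + x \<in> fst s" using cr by auto
    then show "y \<in> fst t" using x by (force simp: tile_minus_def)
  qed
  moreover have "compact (fst t)"
    using s(1) x unfolding is_tile_def tile_minus_def
    by (auto intro!: compact_continuous_image continuous_intros)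
  ultimately show ?thesis using that cr(1) by blast
qed

lemma tiling_dist_0_subset:
  assumes Pr: "\<forall>p\<in>Pr. prototile p" and A: "tiling Pr A" and B: "tiling Pr B"
    and 0: "tiling_dist A B = 0"
  shows "A \<subseteq> B"
proof
  fix t assume t: "t \<in> A"
  obtain c r where cr: "r > 0" "ball c r \<subseteq> fst t" "compact (fst t)"
    using prototile_tile[OF Pr A t] .
  have cin: "c \<in> fst t" using cr by auto
  have near: "\<exists>y. norm y < e \<and> tile_minus t y \<in> B" if "e > 0" for e
  proof -
    define m where "m = Min {e / 2, 1 / sqrt 2, 1 / (norm c + 1)}"
    have nc: "norm c + 1 > 0" using norm_ge_zero[of c] by linarith
    have m: "m > 0" "m \<le> e / 2" "m \<le> 1 / sqrt 2" "m \<le> 1 / (norm c + 1)"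
      using that nc by (auto simp: m_def)
    obtain \<epsilon> where \<epsilon>: "0 < \<epsilon>" "\<epsilon> < m" "tilings_agree A B \<epsilon>"
      using tiling_dist_lessD[of A B m] 0 m by auto
    obtain x y where xy: "norm x \<le> \<epsilon>" "norm y \<le> \<epsilon>"
      "patch (tiling_minus A x) 0 (1/\<epsilon>) = patch (tiling_minus B y) 0 (1/\<epsilon>)"
      using \<epsilon>(3) unfolding tilings_agree_def by auto
    have "1 / sqrt 2 < (1::real)" by simp
    then have "\<epsilon> < 1" using m \<epsilon> by linarith
    have "\<epsilon> * (norm c + 1) < 1"
      proof -
      have "\<epsilon> < 1 / (norm c + 1)" using \<epsilon> m(4) by linarith
      then show ?thesis using pos_less_divide_eq[OF nc] by metis
    qed
    then have "norm c + 1 < 1 / \<epsilon>" using \<epsilon> by (simp add: field_simps)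
    moreover have "norm (c - x) \<le> norm c + norm x" by (rule norm_triangle_ineq4)
    ultimately have "norm (c - x) < 1 / \<epsilon>" using xy(1) \<open>\<epsilon> < 1\<close> by linarith
    then have "c - x \<in> fst (tile_minus t x) \<inter> ball 0 (1/\<epsilon>)"
      using cin by (auto simp: tile_minus_def)
    then have "tile_minus t x \<in> patch (tiling_minus A x) 0 (1/\<epsilon>)"
      using t unfolding patch_def tiling_minus_def by auto
    then have "tile_minus t x \<in> tiling_minus B y" using xy(3) by (auto simp: patch_def)
    then obtain s where s: "s \<in> B" "tile_minus t x = tile_minus s y" unfolding tiling_minus_def by auto
    have "tile_minus t (x - y) = tile_minus (tile_minus t x) (- y)" by (simp add: tile_minus_minus)
    also have "\<dots> = s" using s(2) by (simp add: tile_minus_minus)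
    finally have "tile_minus t (x - y) \<in> B" using s(1) by simp
    moreover have "norm (x - y) < e"
      using norm_triangle_ineq4[of x y] xy \<epsilon> m by linarith
    ultimately show ?thesis by blast
  qed
  obtain y where y: "norm y < r / 2" "tile_minus t y \<in> B" using near[of "r / 2"] cr by auto
  show "t \<in> B"
  proof (cases "y = 0")
    case True
    then show ?thesis using y by simp
  next
    case False
    then obtain z where z: "norm z < norm y" "tile_minus t z \<in> B" using near[of "norm y"] by auto
    define S where "S = fst t"
    have sub: "ball (c - v) r \<subseteq> (\<lambda>p. p - v) ` S" for v
    proof
      fix p assume "p \<in> ball (c - v) r"
      then have "p + v \<in> ball c r" by (simp add: dist_norm algebra_simps)
      then have "p + v \<in> S" using cr by (auto simp: S_def)
      then show "p \<in> (\<lambda>p. p - v) ` S" by force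
    qed
    have "norm (z - y) < r" using norm_triangle_ineq4[of z y] y z by linarith
    then have "c - y \<in> ball (c - y) r \<inter> ball (c - z) r" using cr by (simp add: dist_norm norm_minus_commute)
    moreover have "ball (c - y) r \<inter> ball (c - z) r \<subseteq> interior (fst (tile_minus t y) \<inter> fst (tile_minus t z))"
      using sub by (intro interior_maximal) (auto simp: tile_minus_def S_def)
    ultimately have "interior (fst (tile_minus t y) \<inter> fst (tile_minus t z)) \<noteq> {}" by blast
    then have "tile_minus t y = tile_minus t z"
      using B y(2) z(2) unfolding tiling_def pairwise_def by blast
    then have "(\<lambda>p. p - y) ` S = (\<lambda>p. p - z) ` S" by (simp add: tile_minus_def S_def)
    then have "y = z" using compact_translate_eqD[of S y z] cr cin by (auto simp: S_def)
    then show ?thesis using z by simp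
  qed
qed

lemma tiling_dist_self: "tiling_dist A A = 0"
proof -
  have "tiling_dist A A \<le> e" if "e > 0" for e
    using tiling_dist_le tilings_agree_refl that by blast
  then have "tiling_dist A A \<le> 0" by (rule dense_ge)
  then show ?thesis using tiling_dist_nonneg[of A A] by linarith
qed

lemma tiling_dist_commute: "tiling_dist A B = tiling_dist B A"
  unfolding tiling_dist_def by (simp add: tilings_agree_commute[of A])

lemma Metric_space_tilings:
  assumes "\<forall>p\<in>Pr. prototile p"
  shows "Metric_space {T. tiling Pr T} tiling_dist"
proof
  fix A B C :: "('a, 'b) tiling"
  show "0 \<le> tiling_dist A B" by (rule tiling_dist_nonneg)
  show "tiling_dist A B = tiling_dist B A" by (rule tiling_dist_commute)
  show "tiling_dist A C \<le> tiling_dist A B + tiling_dist B C" by (rule tiling_dist_triangle)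
  assume "A \<in> {T. tiling Pr T}" "B \<in> {T. tiling Pr T}"
  then show "tiling_dist A B = 0 \<longleftrightarrow> A = B"
    using tiling_dist_0_subset[OF assms, of A B] tiling_dist_0_subset[OF assms, of B A]
      tiling_dist_self[of A] tiling_dist_commute[of A B] by auto
qed

lemma Metric_space_tiling_hull:
  assumes "\<forall>p\<in>Pr. prototile p"
  shows "Metric_space (tiling_hull Pr T) tiling_dist"
proof -
  interpret Metric_space "{T. tiling Pr T}" tiling_dist
    using Metric_space_tilings[OF assms] .
  have "tiling_hull Pr T \<subseteq> {T. tiling Pr T}"
    unfolding tiling_hull_def using closure_of_subset_topspace[of mtopology] by simp
  then show ?thesis by (rule subspace)
qed

end

theory Submission
  imports Defs
begin

text \<open>
  Let \<open>h\<close> be a homeomorphism between two hulls. Hulls of tilings of finite local complexity are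
  compact, so \<open>h\<close> is uniformly continuous. In terms of tilings this means that the patch of
  \<open>S\<close> on a large ball around the origin determines, up to a small translation, the patch of
  \<open>h S\<close> on a ball around the origin. The aim is to let the two radii grow together, with a
  ratio that stays bounded.

  The tool for this is rigidity: a tiling which agrees near the origin with one of its small
  translates agrees with it for a zero translation only, because two tiles of a tiling which
  overlap are equal. Hence the small translations provided by uniform continuity are unique, and
  when one moves along an orbit in short steps, consecutive ones must fit together. In this way
  \<open>small_displacement\<close> shows that \<open>h\<close> sends orbits to orbits, with control on the
  translations, and \<open>agree_transfer\<close> shows that two tilings which agree on the ball of radius
  \<open>C * (r + 1)\<close> have images which, after one translation of norm less than \<open>1\<close>, agree on the
  ball of radius \<open>r\<close>.

  It remains to count. A tiling of the second transversal is, up to a bounded translation, the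
  image of a tiling of the first one, whose patch of radius \<open>C * (r + 1)\<close> thus determines the
  patch of radius \<open>r\<close> of the image up to a bounded translation. This translation joins two
  points of a Delaunay set, and the number of its possible values is bounded uniformly. This is
  \<open>complexity_comparison\<close>: the complexity of the second transversal at \<open>r\<close> is at most
  a constant times that of the first at \<open>C * (r + 1)\<close>. Together with the same inequality
  for the inverse of \<open>h\<close> it shows that polynomial growth and its exponent are preserved. The
  identity map gives the independence of the transversal, and the centres of the tiles form a
  pointing rule, so that a transversal of the second space exists.
\<close>

notation tiling_minus (infixl "\<ominus>" 65)

section \<open>Agreement of tilings on balls\<close>

definition agree :: "('a::euclidean_space, 'l) tiling \<Rightarrow> ('a, 'l) tiling \<Rightarrow> real \<Rightarrow> bool" where
  "agree A B r \<longleftrightarrow> patch A 0 r = patch B 0 r"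

lemma agree_refl [simp]: "agree A A r"
  by (simp add: agree_def)

lemma agree_sym: "agree A B r \<Longrightarrow> agree B A r"
  by (simp add: agree_def)

lemma agree_trans: "agree A B r \<Longrightarrow> agree B C r \<Longrightarrow> agree A C r"
  by (simp add: agree_def)

lemma agree_mono: "agree A B r \<Longrightarrow> s \<le> r \<Longrightarrow> agree A B s"
  unfolding agree_def by (erule patch_eq_subball) (simp add: subset_ball)

lemma agree_shift:
  assumes "agree A B r" "norm x + s \<le> r"
  shows "agree (A \<ominus> x) (B \<ominus> x) s"
proof -
  have "ball x s \<subseteq> ball 0 r"
    using assms(2) by (simp add: ball_subset_ball_iff dist_norm)
  then have "patch A x s = patch B x s"
    using assms(1) unfolding agree_def by (rule patch_eq_subball[rotated])
  then show ?thesis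
    by (simp add: agree_def patch_tiling_minus)
qed

lemma agree_imp_mem:
  assumes "agree A B r" "t \<in> A" "fst t \<inter> ball 0 r \<noteq> {}"
  shows "t \<in> B"
  using assms unfolding agree_def patch_def by blast

lemma agreeI:
  assumes "\<And>t. fst t \<inter> ball 0 r \<noteq> {} \<Longrightarrow> t \<in> A \<longleftrightarrow> t \<in> B"
  shows "agree A B r"
  using assms unfolding agree_def patch_def by blast

lemma mem_tiling_minus: "t \<in> T \<ominus> x \<longleftrightarrow> tile_minus t (- x) \<in> T"
proof
  assume "t \<in> T \<ominus> x"
  then show "tile_minus t (- x) \<in> T"
    by (auto simp: tiling_minus_def tile_minus_minus)
next
  assume "tile_minus t (- x) \<in> T"
  then have "tile_minus (tile_minus t (- x)) x \<in> T \<ominus> x"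
    unfolding tiling_minus_def by (rule imageI)
  then show "t \<in> T \<ominus> x" by (simp add: tile_minus_minus)
qed

text \<open>A tile that meets a ball does so at some point, so agreement can be checked around each
  point of the ball separately.\<close>

lemma agree_from_translates:
  assumes "\<And>z. norm z < r \<Longrightarrow> \<exists>s>0. agree (A \<ominus> z) (B \<ominus> z) s"
  shows "agree A B r"
proof (rule agreeI)
  fix t :: "('a, 'b) tile"
  assume "fst t \<inter> ball 0 r \<noteq> {}"
  then obtain z where z: "z \<in> fst t" "norm z < r" by auto
  obtain s where s: "s > 0" "agree (A \<ominus> z) (B \<ominus> z) s"
    using assms[OF z(2)] by blast
  have 0: "0 \<in> fst (tile_minus t z) \<inter> ball 0 s"
    using z s(1) by (force simp: tile_minus_def)
  have *: "tile_minus t z \<in> C \<ominus> z \<longleftrightarrow> t \<in> C" for C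
    by (simp add: mem_tiling_minus tile_minus_minus)
  show "t \<in> A \<longleftrightarrow> t \<in> B"
    using agree_imp_mem[OF s(2), of "tile_minus t z"]
      agree_imp_mem[OF agree_sym[OF s(2)], of "tile_minus t z"] 0 * by blast
qed

lemma agree_all_imp_eq:
  assumes "\<And>L. agree A B L" "\<And>t. t \<in> A \<union> B \<Longrightarrow> fst t \<noteq> {}"
  shows "A = B"
proof -
  have "t \<in> A \<longleftrightarrow> t \<in> B" if t: "t \<in> A \<union> B" for t
  proof -
    obtain z where z: "z \<in> fst t" using assms(2)[OF t] by auto
    then have "z \<in> fst t \<inter> ball 0 (norm z + 1)" by simp
    then show ?thesis
      using agree_imp_mem[OF assms(1)[of "norm z + 1"], of t]
        agree_imp_mem[OF agree_sym[OF assms(1)[of "norm z + 1"]], of t] by blast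
  qed
  then show ?thesis by blast
qed

lemma inverse_sqrt2_ge_half: "1 / 2 \<le> 1 / sqrt 2"
  using real_sqrt_le_mono[of 2 4] by (simp add: field_simps)

text \<open>This fact and the next turn the distance, which allows a translation of each of the two
  tilings, into agreement after a single small translation; merging the two translations costs
  the summand \<open>- e\<close> in the radius.\<close>

lemma dist_small_imp_agree:
  assumes "tiling_dist A B < e" "e \<le> 1 / sqrt 2"
  obtains x where "norm x < 2 * e" "agree A (B \<ominus> x) (1 / e - e)"
proof -
  obtain \<epsilon> where \<epsilon>: "0 < \<epsilon>" "\<epsilon> < e" "tilings_agree A B \<epsilon>"
    using tiling_dist_lessD[OF assms] .
  obtain u v where uv: "norm u \<le> \<epsilon>" "norm v \<le> \<epsilon>" "agree (A \<ominus> u) (B \<ominus> v) (1 / \<epsilon>)"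
    using \<epsilon>(3) unfolding tilings_agree_def agree_def by auto
  have "1 / e < 1 / \<epsilon>" using \<epsilon> by (simp add: frac_less2)
  then have "norm (- u) + (1 / e - e) \<le> 1 / \<epsilon>" using uv \<epsilon> by simp
  then have "agree (A \<ominus> u \<ominus> - u) (B \<ominus> v \<ominus> - u) (1 / e - e)"
    using agree_shift[OF uv(3)] by blast
  then have "agree A (B \<ominus> (v - u)) (1 / e - e)"
    by (simp add: tiling_minus_minus)
  moreover have "norm (v - u) < 2 * e"
    using norm_triangle_ineq4[of v u] uv \<epsilon> by linarith
  ultimately show ?thesis using that by blast
qed

lemma agree_imp_dist_le:
  assumes "agree A (B \<ominus> x) r" "norm x \<le> e" "0 < e" "1 / e \<le> r"
  shows "tiling_dist A B \<le> e"
proof (rule tiling_dist_le[OF assms(3)])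
  have "agree (A \<ominus> 0) (B \<ominus> x) (1 / e)"
    using agree_mono[OF assms(1,4)] by simp
  then show "tilings_agree A B e"
    unfolding tilings_agree_def agree_def using assms(2,3)
    by (metis norm_zero less_imp_le)
qed

section \<open>Maps that send orbits to orbits\<close>

text \<open>Uniform continuity for the tiling distance, stated with separate bounds for the radius of
  agreement and for the translation, because \<open>small_displacement\<close> fixes the bound for the
  translation and lets the radius grow.\<close>

definition patch_continuous ::
    "('a::euclidean_space, 'l) tiling set \<Rightarrow> (('a, 'l) tiling \<Rightarrow> ('a, 'm) tiling) \<Rightarrow> bool" where
  "patch_continuous \<Omega> h \<longleftrightarrow> (\<forall>L. \<forall>\<epsilon>>0. \<exists>K. \<exists>\<delta>>0. \<forall>A\<in>\<Omega>. \<forall>B\<in>\<Omega>. \<forall>x.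
     norm x < \<delta> \<and> agree A (B \<ominus> x) K \<longrightarrow> (\<exists>y. norm y < \<epsilon> \<and> agree (h A) (h B \<ominus> y) L))"

lemma uniformly_continuous_imp_patch_continuous:
  assumes "\<And>\<epsilon>. \<epsilon> > 0 \<Longrightarrow> \<exists>\<delta>>0. \<forall>A\<in>\<Omega>. \<forall>B\<in>\<Omega>.
    tiling_dist A B < \<delta> \<longrightarrow> tiling_dist (h A) (h B) < \<epsilon>"
  shows "patch_continuous \<Omega> h"
  unfolding patch_continuous_def
proof (intro allI impI)
  fix L \<epsilon> :: real assume "\<epsilon> > 0"
  define e where "e = min (min (\<epsilon> / 2) (1 / 2)) (1 / (\<bar>L\<bar> + 1))"
  have e: "0 < e" "e \<le> \<epsilon> / 2" "e \<le> 1 / 2" "e \<le> 1 / (\<bar>L\<bar> + 1)"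
    using \<open>\<epsilon> > 0\<close> unfolding e_def by (auto simp: add_nonneg_pos)
  have "e \<le> 1 / sqrt 2"
    using e(3) inverse_sqrt2_ge_half by linarith
  have "e * (\<bar>L\<bar> + 1) \<le> 1" using e(4) by (simp add: field_simps)
  then have "\<bar>L\<bar> + 1 \<le> 1 / e" using e(1) by (simp add: field_simps)
  then have Le: "L \<le> 1 / e - e" using e(3) by linarith
  obtain \<delta> where \<delta>: "\<delta> > 0"
    "\<And>A B. A \<in> \<Omega> \<Longrightarrow> B \<in> \<Omega> \<Longrightarrow> tiling_dist A B < \<delta> \<Longrightarrow> tiling_dist (h A) (h B) < e"
    using assms[OF e(1)] by blast
  show "\<exists>K. \<exists>\<delta>>0. \<forall>A\<in>\<Omega>. \<forall>B\<in>\<Omega>. \<forall>x. norm x < \<delta> \<and> agree A (B \<ominus> x) K \<longrightarrow>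
      (\<exists>y. norm y < \<epsilon> \<and> agree (h A) (h B \<ominus> y) L)"
  proof (rule exI[of _ "2 / \<delta>"], rule exI[of _ "\<delta> / 2"], intro conjI ballI allI impI)
    fix A B x assume AB: "A \<in> \<Omega>" "B \<in> \<Omega>" and x: "norm x < \<delta> / 2 \<and> agree A (B \<ominus> x) (2 / \<delta>)"
    then have "tiling_dist A B \<le> \<delta> / 2"
      using \<delta>(1) by (intro agree_imp_dist_le[of A B x "2 / \<delta>"]) auto
    then have "tiling_dist (h A) (h B) < e" using \<delta> AB by simp
    then obtain y where "norm y < 2 * e" "agree (h A) (h B \<ominus> y) (1 / e - e)"
      using dist_small_imp_agree \<open>e \<le> 1 / sqrt 2\<close> by blast
    then have "norm y < \<epsilon>" "agree (h A) (h B \<ominus> y) L"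
      using e(2) Le by (auto elim: agree_mono)
    then show "\<exists>y. norm y < \<epsilon> \<and> agree (h A) (h B \<ominus> y) L" by blast
  qed (use \<delta> in simp)
qed

text \<open>A tiling of \<open>\<Omega>\<close> looks different near the origin from its small nonzero translates.
  Comparisons of orbits use the geometry of tiles through this property: it makes a small
  translation between two tilings unique. The radius \<open>1\<close> stands for any positive radius, since
  every ball around the origin meets a tile.\<close>

definition rigid :: "('a::euclidean_space, 'l) tiling set \<Rightarrow> bool" where
  "rigid \<Omega> \<longleftrightarrow> (\<exists>\<kappa>>0. \<forall>A\<in>\<Omega>. \<forall>w. norm w < \<kappa> \<and> agree A (A \<ominus> w) 1 \<longrightarrow> w = 0)"

locale tiling_map =
  fixes \<Omega> :: "('a::euclidean_space, 'l) tiling set"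
    and \<Omega>' :: "('a, 'm) tiling set"
    and h :: "('a, 'l) tiling \<Rightarrow> ('a, 'm) tiling"
  assumes inv: "\<And>T x. T \<in> \<Omega> \<Longrightarrow> T \<ominus> x \<in> \<Omega>"
    and inv': "\<And>T x. T \<in> \<Omega>' \<Longrightarrow> T \<ominus> x \<in> \<Omega>'"
    and maps: "\<And>T. T \<in> \<Omega> \<Longrightarrow> h T \<in> \<Omega>'"
    and cont: "patch_continuous \<Omega> h"
    and rigid': "rigid \<Omega>'"
    and nonempty': "\<And>T t. T \<in> \<Omega>' \<Longrightarrow> t \<in> T \<Longrightarrow> fst t \<noteq> {}"
begin

lemma translation_unique:
  obtains \<kappa> where "\<kappa> > 0"
    "\<And>A B u v. A \<in> \<Omega>' \<Longrightarrow> agree B (A \<ominus> u) 1 \<Longrightarrow> agree B (A \<ominus> v) 1 \<Longrightarrow> norm (u - v) < \<kappa> \<Longrightarrow> u = v"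
proof -
  obtain \<kappa> where \<kappa>: "\<kappa> > 0" "\<And>A w. A \<in> \<Omega>' \<Longrightarrow> norm w < \<kappa> \<Longrightarrow> agree A (A \<ominus> w) 1 \<Longrightarrow> w = 0"
    using rigid' unfolding rigid_def by blast
  have "u = v" if "A \<in> \<Omega>'" "agree B (A \<ominus> u) 1" "agree B (A \<ominus> v) 1" "norm (u - v) < \<kappa>" for A B u v
  proof -
    have "agree (A \<ominus> v) (A \<ominus> v \<ominus> (u - v)) 1"
      using agree_trans[OF agree_sym[OF that(3)] that(2)] by (simp add: tiling_minus_minus)
    then have "u - v = 0" using \<kappa>(2)[of "A \<ominus> v"] that inv' by blast
    then show ?thesis by simp
  qed
  then show ?thesis using that \<kappa>(1) by blast
qed

text \<open>The image of a short segment of an orbit stays in one orbit. Along the segment the image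
  agrees near the origin with its starting point after a unique small translation; moving in
  steps so short that the image hardly changes on a ball of radius \<open>L\<close>, this translation also
  yields agreement on that ball. As \<open>L\<close> is arbitrary, the two tilings are translates.\<close>

lemma small_displacement:
  assumes "\<epsilon> > 0"
  obtains \<delta> where "\<delta> > 0"
    "\<And>T x. T \<in> \<Omega> \<Longrightarrow> norm x < \<delta> \<Longrightarrow> \<exists>z. norm z < \<epsilon> \<and> h (T \<ominus> x) = h T \<ominus> z"
proof -
  obtain \<kappa> where \<kappa>: "\<kappa> > 0"
    "\<And>A B u v. A \<in> \<Omega>' \<Longrightarrow> agree B (A \<ominus> u) 1 \<Longrightarrow> agree B (A \<ominus> v) 1 \<Longrightarrow> norm (u - v) < \<kappa> \<Longrightarrow> u = v"
    by (rule translation_unique) blast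
  \<comment> \<open>Uniqueness will be applied to differences of three translations of norm less than \<open>e\<close>.\<close>
  define e where "e = min (min \<epsilon> (1/2)) (\<kappa> / 4)"
  have e: "e > 0" "e \<le> \<epsilon>" "e \<le> 1/2" "4 * e \<le> \<kappa>"
    using assms \<kappa>(1) by (auto simp: e_def)
  obtain K \<delta> where \<delta>: "\<delta> > 0" and K: "\<And>A B x. A \<in> \<Omega> \<Longrightarrow> B \<in> \<Omega> \<Longrightarrow> norm x < \<delta> \<Longrightarrow>
      agree A (B \<ominus> x) K \<Longrightarrow> \<exists>y. norm y < e \<and> agree (h A) (h B \<ominus> y) 1"
    using cont e(1) unfolding patch_continuous_def by meson
  have "\<exists>z. norm z < \<epsilon> \<and> h (T \<ominus> x) = h T \<ominus> z" if T: "T \<in> \<Omega>" and x: "norm x < \<delta>" for T x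
  proof -
    have "\<forall>s. \<exists>y. 0 \<le> s \<and> s \<le> 1 \<longrightarrow> norm y < e \<and> agree (h T) (h (T \<ominus> s *\<^sub>R x) \<ominus> y) 1"
    proof (intro allI)
      fix s :: real
      have "\<exists>y. norm y < e \<and> agree (h T) (h (T \<ominus> s *\<^sub>R x) \<ominus> y) 1" if "0 \<le> s" "s \<le> 1"
      proof (rule K[OF T inv[OF T]])
        have "norm (s *\<^sub>R x) \<le> norm x" using that by (simp add: mult_left_le_one_le)
        then show "norm (- (s *\<^sub>R x)) < \<delta>" using x by simp
      qed (simp add: tiling_minus_minus)
      then show "\<exists>y. 0 \<le> s \<and> s \<le> 1 \<longrightarrow> norm y < e \<and> agree (h T) (h (T \<ominus> s *\<^sub>R x) \<ominus> y) 1" by blast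
    qed
    then obtain y where y: "\<And>s. 0 \<le> s \<Longrightarrow> s \<le> 1 \<Longrightarrow> norm (y s) < e"
      "\<And>s. 0 \<le> s \<Longrightarrow> s \<le> 1 \<Longrightarrow> agree (h T) (h (T \<ominus> s *\<^sub>R x) \<ominus> y s) 1"
      by metis
    have y0: "y 0 = 0"
      using \<kappa>(2)[of "h T" "h T" "y 0" 0] y(1,2)[of 0] maps[OF T] e by simp
    have "agree (h T) (h (T \<ominus> x) \<ominus> y 1) L" if L: "L \<ge> 1" for L
    proof -
      \<comment> \<open>Only the length of the steps depends on \<open>L\<close>; the translations \<open>y s\<close> do not.\<close>
      obtain K' \<delta>' where \<delta>': "\<delta>' > 0" and K': "\<And>A B x. A \<in> \<Omega> \<Longrightarrow> B \<in> \<Omega> \<Longrightarrow> norm x < \<delta>' \<Longrightarrow>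
          agree A (B \<ominus> x) K' \<Longrightarrow> \<exists>y. norm y < e \<and> agree (h A) (h B \<ominus> y) (L + 1)"
        using cont e(1) unfolding patch_continuous_def by meson
      obtain n :: nat where n: "norm x / \<delta>' < real n" using reals_Archimedean2 by blast
      have n0: "real n > 0" using n \<delta>' by (metis divide_nonneg_pos le_less_trans norm_ge_zero)
      have "agree (h T) (h (T \<ominus> (real i / real n) *\<^sub>R x) \<ominus> y (real i / real n)) L" if "i \<le> n" for i
        using that
      proof (induction i)
        case 0
        then show ?case using y0 by simp
      next
        case (Suc i)
        define s where "s = real i / real n"
        define s' where "s' = real (Suc i) / real n"
        have s: "0 \<le> s" "s \<le> 1" "0 \<le> s'" "s' \<le> 1" "s' - s = 1 / real n"
          using Suc.prems n0 by (auto simp: s_def s'_def field_simps)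
        have "norm ((s - s') *\<^sub>R x) < \<delta>'"
        proof -
          have "norm ((s - s') *\<^sub>R x) = norm x / real n"
            using s(5) by (simp add: abs_minus_commute)
          also have "\<dots> < \<delta>'" using n n0 \<delta>' by (simp add: field_simps)
          finally show ?thesis .
        qed
        then obtain u where u: "norm u < e"
          "agree (h (T \<ominus> s *\<^sub>R x)) (h (T \<ominus> s' *\<^sub>R x) \<ominus> u) (L + 1)"
          using K'[of "T \<ominus> s *\<^sub>R x" "T \<ominus> s' *\<^sub>R x" "(s - s') *\<^sub>R x"] inv[OF T]
          by (auto simp: tiling_minus_minus algebra_simps)
        have "agree (h (T \<ominus> s *\<^sub>R x) \<ominus> y s) (h (T \<ominus> s' *\<^sub>R x) \<ominus> u \<ominus> y s) L"
          using u(2) y(1)[OF s(1,2)] e by (intro agree_shift[of _ _ "L + 1"]) auto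
        moreover have "agree (h T) (h (T \<ominus> s *\<^sub>R x) \<ominus> y s) L"
          using Suc by (simp add: s_def)
        ultimately have *: "agree (h T) (h (T \<ominus> s' *\<^sub>R x) \<ominus> (u + y s)) L"
          unfolding tiling_minus_minus by (rule agree_trans[rotated])
        have "norm (u + y s - y s') < \<kappa>"
          using u(1) y(1)[OF s(1,2)] y(1)[OF s(3,4)] e
            norm_triangle_ineq4[of "u + y s" "y s'"] norm_triangle_ineq[of u "y s"] by linarith
        then have "u + y s = y s'"
          using \<kappa>(2)[OF maps[OF inv[OF T]] agree_mono[OF * L] y(2)[OF s(3,4)]] by blast
        then show ?case using * by (simp add: s'_def)
      qed
      from this[of n] show ?thesis using n0 by simp
    qed
    then have "agree (h T) (h (T \<ominus> x) \<ominus> y 1) L" for L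
      by (meson agree_mono linear)
    then have "h T = h (T \<ominus> x) \<ominus> y 1"
      by (rule agree_all_imp_eq) (use nonempty' maps inv inv' T in blast)
    then have "h (T \<ominus> x) = h T \<ominus> - y 1" by (simp add: tiling_minus_minus)
    then show ?thesis using y(1)[of 1] e by (intro exI[of _ "- y 1"]) auto
  qed
  then show ?thesis using that \<delta> by blast
qed

text \<open>A long segment is cut into steps to which the previous lemma applies; their number is
  linear in the length.\<close>

lemma linear_displacement:
  obtains C where "C > 0"
    "\<And>T x. T \<in> \<Omega> \<Longrightarrow> \<exists>z. norm z \<le> C * (norm x + 1) \<and> h (T \<ominus> x) = h T \<ominus> z"
proof -
  obtain \<delta> where \<delta>: "\<delta> > 0"
    "\<And>T x. T \<in> \<Omega> \<Longrightarrow> norm x < \<delta> \<Longrightarrow> \<exists>z. norm z < 1 \<and> h (T \<ominus> x) = h T \<ominus> z"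
    using small_displacement[of 1] by auto
  define C where "C = max 1 (1 / \<delta>)"
  have "\<exists>z. norm z \<le> C * (norm x + 1) \<and> h (T \<ominus> x) = h T \<ominus> z" if T: "T \<in> \<Omega>" for T x
  proof -
    define n where "n = Suc (nat \<lfloor>norm x / \<delta>\<rfloor>)"
    have n: "norm x / \<delta> < real n" "real n \<le> norm x / \<delta> + 1"
      using \<delta>(1) by (auto simp: n_def) linarith+
    have "real n > 0" by (simp add: n_def)
    then have step: "norm ((1 / real n) *\<^sub>R x) < \<delta>"
      using n(1) \<delta>(1) by (simp add: field_simps)
    have "\<exists>z. norm z \<le> real i \<and> h (T \<ominus> (real i / real n) *\<^sub>R x) = h T \<ominus> z" for i
    proof (induction i)
      case 0
      show ?case by (intro exI[of _ 0]) simp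
    next
      case (Suc i)
      then obtain z where z: "norm z \<le> real i" "h (T \<ominus> (real i / real n) *\<^sub>R x) = h T \<ominus> z" by blast
      obtain w where w: "norm w < 1"
        "h (T \<ominus> (real i / real n) *\<^sub>R x \<ominus> (1 / real n) *\<^sub>R x) = h T \<ominus> z \<ominus> w"
        using \<delta>(2)[OF inv[OF T] step] z(2) by metis
      have "(real i / real n) *\<^sub>R x + (1 / real n) *\<^sub>R x = (real (Suc i) / real n) *\<^sub>R x"
        by (simp add: scaleR_add_left[symmetric] add_divide_distrib)
      then have "h (T \<ominus> (real (Suc i) / real n) *\<^sub>R x) = h T \<ominus> (z + w)"
        using w(2) by (simp only: tiling_minus_minus)
      moreover have "norm (z + w) \<le> real (Suc i)"
        using norm_triangle_ineq[of z w] z(1) w(1) by simp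
      ultimately show ?case by blast
    qed
    from this[of n] obtain z where z: "norm z \<le> real n" "h (T \<ominus> x) = h T \<ominus> z"
      by (auto simp: n_def)
    have "norm x / \<delta> \<le> C * norm x" "1 \<le> C"
      using mult_right_mono[of "1 / \<delta>" C "norm x"] by (auto simp: C_def)
    then have "norm z \<le> C * (norm x + 1)" using z n by (simp add: algebra_simps)
    then show ?thesis using z by blast
  qed
  moreover have "C > 0" by (simp add: C_def)
  ultimately show ?thesis using that by blast
qed

end

locale tiling_equivalence =
  forward: tiling_map \<Omega> \<Omega>' h + backward: tiling_map \<Omega>' \<Omega> g
  for \<Omega> :: "('a::euclidean_space, 'l) tiling set"
    and \<Omega>' :: "('a, 'm) tiling set"
    and h g +
  assumes left_inverse: "\<And>T. T \<in> \<Omega> \<Longrightarrow> g (h T) = T"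
    and right_inverse: "\<And>T. T \<in> \<Omega>' \<Longrightarrow> h (g T) = T"
begin

text \<open>Agreement is transported by an equivalence with a linear loss of radius. For a point
  \<open>z\<close> of the target ball, one walks from \<open>0\<close> to \<open>z\<close> in short steps
  and lifts the walk by the inverse map to a walk in the orbit of \<open>T\<^sub>1\<close>, which stays within
  a distance linear in \<open>norm z\<close>. All along that walk \<open>T\<^sub>1\<close> and \<open>T\<^sub>2\<close>
  look alike, so their images look alike up to a small translation; by uniqueness of small
  translations, the images of \<open>T\<^sub>1\<close> and \<open>T\<^sub>2\<close> themselves are related near each point of
  the walk by one and the same translation.\<close>

lemma agree_transfer:
  obtains C where "C > 0"
    "\<And>T\<^sub>1 T\<^sub>2 r. T\<^sub>1 \<in> \<Omega> \<Longrightarrow> T\<^sub>2 \<in> \<Omega> \<Longrightarrow> r \<ge> 0 \<Longrightarrow> agree T\<^sub>1 T\<^sub>2 (C * (r + 1)) \<Longrightarrow>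
      \<exists>y. norm y < 1 \<and> agree (h T\<^sub>1) (h T\<^sub>2 \<ominus> y) r"
proof -
  obtain \<kappa> where \<kappa>: "\<kappa> > 0"
    "\<And>A B u v. A \<in> \<Omega>' \<Longrightarrow> agree B (A \<ominus> u) 1 \<Longrightarrow> agree B (A \<ominus> v) 1 \<Longrightarrow> norm (u - v) < \<kappa> \<Longrightarrow> u = v"
    by (rule forward.translation_unique) blast
  \<comment> \<open>Uniqueness will be applied to differences of four vectors of norm less than \<open>e\<close>;
    agreement with radius \<open>2\<close> leaves radius \<open>1\<close> after a step of norm at most \<open>1\<close>.\<close>
  define e where "e = min 1 (\<kappa> / 4)"
  have e: "e > 0" "e \<le> 1" "4 * e \<le> \<kappa>" using \<kappa>(1) by (auto simp: e_def)
  obtain K \<delta>\<^sub>0 where \<delta>\<^sub>0: "\<delta>\<^sub>0 > 0" and K0: "\<And>A B x. A \<in> \<Omega> \<Longrightarrow> B \<in> \<Omega> \<Longrightarrow> norm x < \<delta>\<^sub>0 \<Longrightarrow>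
      agree A (B \<ominus> x) K \<Longrightarrow> \<exists>y. norm y < e \<and> agree (h A) (h B \<ominus> y) 2"
    using forward.cont e(1) unfolding patch_continuous_def by meson
  have K: "\<exists>y. norm y < e \<and> agree (h A) (h B \<ominus> y) 2" if "A \<in> \<Omega>" "B \<in> \<Omega>" "agree A B K" for A B
    using K0[of A B 0] that \<delta>\<^sub>0 by simp
  obtain \<delta> where \<delta>: "\<delta> > 0"
    "\<And>T x. T \<in> \<Omega> \<Longrightarrow> norm x < \<delta> \<Longrightarrow> \<exists>z. norm z < e \<and> h (T \<ominus> x) = h T \<ominus> z"
    by (rule forward.small_displacement[OF e(1)]) blast
  obtain \<eta> where \<eta>: "\<eta> > 0"
    "\<And>T x. T \<in> \<Omega>' \<Longrightarrow> norm x < \<eta> \<Longrightarrow> \<exists>z. norm z < \<delta> \<and> g (T \<ominus> x) = g T \<ominus> z"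
    by (rule backward.small_displacement[OF \<delta>(1)]) blast
  define \<sigma> where "\<sigma> = min \<eta> e"
  have \<sigma>: "\<sigma> > 0" "\<sigma> \<le> \<eta>" "\<sigma> \<le> e" using \<eta>(1) e(1) by (auto simp: \<sigma>_def)
  define C where "C = \<delta> / \<sigma> + \<delta> + \<bar>K\<bar>"
  have "C > 0" using \<delta>(1) \<sigma>(1) by (simp add: C_def add_pos_nonneg)
  moreover have "\<exists>y. norm y < 1 \<and> agree (h T\<^sub>1) (h T\<^sub>2 \<ominus> y) r"
    if T1: "T\<^sub>1 \<in> \<Omega>" and T2: "T\<^sub>2 \<in> \<Omega>" and r: "r \<ge> 0" and ag: "agree T\<^sub>1 T\<^sub>2 (C * (r + 1))"
    for T\<^sub>1 T\<^sub>2 r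
  proof -
    have C: "(r / \<sigma> + 1) * \<delta> + K \<le> C * (r + 1)"
    proof -
      have "0 \<le> \<delta> / \<sigma> + r * \<delta> + \<bar>K\<bar> * r + (\<bar>K\<bar> - K)"
        using r \<delta>(1) \<sigma>(1) by (intro add_nonneg_nonneg) auto
      then have "(r / \<sigma> + 1) * \<delta> + K \<le> (r / \<sigma> + 1) * \<delta> + K + (\<delta> / \<sigma> + r * \<delta> + \<bar>K\<bar> * r + (\<bar>K\<bar> - K))"
        by simp
      also have "\<dots> = C * (r + 1)" by (simp add: C_def algebra_simps add_divide_distrib)
      finally show ?thesis .
    qed
    have "K \<le> (r / \<sigma> + 1) * \<delta> + K" using r \<delta>(1) \<sigma>(1) by simp
    then obtain y\<^sub>0 where y0: "norm y\<^sub>0 < e" "agree (h T\<^sub>1) (h T\<^sub>2 \<ominus> y\<^sub>0) 2"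
      using K[OF T1 T2 agree_mono[OF ag]] C by auto
    have "agree (h T\<^sub>1 \<ominus> z) (h T\<^sub>2 \<ominus> y\<^sub>0 \<ominus> z) 2" if z: "norm z < r" for z
    proof -
      define n where "n = Suc (nat \<lfloor>norm z / \<sigma>\<rfloor>)"
      have n: "real n > 0" "norm z / \<sigma> < real n" "real n \<le> norm z / \<sigma> + 1"
      proof -
        show "real n > 0" by (simp add: n_def)
        have "0 \<le> norm z / \<sigma>" using \<sigma>(1) by simp
        then show "norm z / \<sigma> < real n" "real n \<le> norm z / \<sigma> + 1"
          unfolding n_def by linarith+
      qed
      define dz where "dz = (1 / real n) *\<^sub>R z"
      have "norm dz = norm z / real n" by (simp add: dz_def)
      also have "\<dots> < \<sigma>" using n \<sigma>(1) by (simp add: field_simps)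
      finally have dz: "norm dz < \<sigma>" .
      have "real n * \<delta> \<le> (norm z / \<sigma> + 1) * \<delta>" using n(3) \<delta>(1) by simp
      also have "\<dots> \<le> (r / \<sigma> + 1) * \<delta>"
        using z \<sigma>(1) \<delta>(1) by (simp add: divide_right_mono)
      finally have "real n * \<delta> + K \<le> C * (r + 1)" using C by linarith
      then have agn: "agree T\<^sub>1 T\<^sub>2 (real n * \<delta> + K)" by (rule agree_mono[OF ag])
      \<comment> \<open>After \<open>i\<close> steps \<open>x\<close> is the end of the lifted walk, \<open>v\<close> the displacement of the
        image of \<open>T\<^sub>2\<close>, and \<open>y\<close> the small translation found there. The invariant is that
        the total translation \<open>v + y\<close> exceeds the displacement of the image of \<open>T\<^sub>1\<close> by
        exactly \<open>y\<^sub>0\<close>.\<close>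
      have "\<exists>x v y. norm x \<le> real i * \<delta> \<and> norm y < e \<and> h (T\<^sub>1 \<ominus> x) = h T\<^sub>1 \<ominus> real i *\<^sub>R dz \<and>
          h (T\<^sub>2 \<ominus> x) = h T\<^sub>2 \<ominus> v \<and> v + y = y\<^sub>0 + real i *\<^sub>R dz \<and>
          agree (h T\<^sub>1 \<ominus> real i *\<^sub>R dz) (h T\<^sub>2 \<ominus> (v + y)) 2" if "i \<le> n" for i
        using that
      proof (induction i)
        case 0
        show ?case using y0 by (intro exI[of _ 0] exI[of _ y\<^sub>0]) simp
      next
        case (Suc i)
        then obtain x v y where xv: "norm x \<le> real i * \<delta>" "norm y < e"
          "h (T\<^sub>1 \<ominus> x) = h T\<^sub>1 \<ominus> real i *\<^sub>R dz" "h (T\<^sub>2 \<ominus> x) = h T\<^sub>2 \<ominus> v"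
          "v + y = y\<^sub>0 + real i *\<^sub>R dz" "agree (h T\<^sub>1 \<ominus> real i *\<^sub>R dz) (h T\<^sub>2 \<ominus> (v + y)) 2"
          by auto
        have iz: "real i *\<^sub>R dz + dz = real (Suc i) *\<^sub>R dz"
          by (simp add: algebra_simps)
        have "h T\<^sub>1 \<ominus> real i *\<^sub>R dz \<in> \<Omega>'" "g (h T\<^sub>1 \<ominus> real i *\<^sub>R dz) = T\<^sub>1 \<ominus> x"
          using xv(3) left_inverse[OF forward.inv[OF T1]] forward.maps[OF T1] forward.inv' by metis+
        then obtain s where s: "norm s < \<delta>" "g (h T\<^sub>1 \<ominus> real i *\<^sub>R dz \<ominus> dz) = T\<^sub>1 \<ominus> x \<ominus> s"
          using \<eta>(2)[of "h T\<^sub>1 \<ominus> real i *\<^sub>R dz" dz] dz \<sigma>(2) by auto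
        have s1: "h (T\<^sub>1 \<ominus> (x + s)) = h T\<^sub>1 \<ominus> real (Suc i) *\<^sub>R dz"
          using s(2) right_inverse[of "h T\<^sub>1 \<ominus> real (Suc i) *\<^sub>R dz"] forward.maps[OF T1] forward.inv'
          by (simp only: tiling_minus_minus iz)
        obtain v' where v': "norm v' < e" "h (T\<^sub>2 \<ominus> (x + s)) = h T\<^sub>2 \<ominus> (v + v')"
          using \<delta>(2)[OF forward.inv[OF T2] s(1), of x] xv(4) by (auto simp: tiling_minus_minus)
        have xs: "norm (x + s) \<le> real (Suc i) * \<delta>"
          using norm_triangle_ineq[of x s] xv(1) s(1) by (simp add: algebra_simps)
        have "real (Suc i) * \<delta> \<le> real n * \<delta>" using Suc.prems \<delta>(1) by simp
        then have "agree (T\<^sub>1 \<ominus> (x + s)) (T\<^sub>2 \<ominus> (x + s)) K"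
          using xs by (intro agree_shift[OF agn]) linarith
        then obtain y' where y': "norm y' < e"
          "agree (h T\<^sub>1 \<ominus> real (Suc i) *\<^sub>R dz) (h T\<^sub>2 \<ominus> (v + v' + y')) 2"
          using K[OF forward.inv[OF T1] forward.inv[OF T2]] s1 v'(2)
          by (metis tiling_minus_minus)
        have "agree (h T\<^sub>1 \<ominus> real i *\<^sub>R dz \<ominus> dz) (h T\<^sub>2 \<ominus> (v + y) \<ominus> dz) 1"
          using dz \<sigma>(3) e(2) by (intro agree_shift[OF xv(6)]) simp
        then have *: "agree (h T\<^sub>1 \<ominus> real (Suc i) *\<^sub>R dz) (h T\<^sub>2 \<ominus> (v + y + dz)) 1"
          by (simp only: tiling_minus_minus iz)
        have "norm (v + v' + y' - (v + y + dz)) \<le> norm v' + norm y' + norm y + norm dz"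
          using norm_triangle_ineq4[of "v' + y'" "y + dz"] norm_triangle_ineq[of v' y']
            norm_triangle_ineq[of y dz] by (simp add: algebra_simps)
        also have "\<dots> < \<kappa>" using v'(1) y'(1) xv(2) dz \<sigma>(3) e(3) by linarith
        finally have "v + v' + y' = v + y + dz"
          using \<kappa>(2)[OF forward.maps[OF T2] agree_mono[OF y'(2)] *] by simp
        then have "v + v' + y' = y\<^sub>0 + real (Suc i) *\<^sub>R dz"
          using xv(5) iz by (simp add: add.assoc)
        then show ?case using xs y' s1 v'(2) by blast
      qed
      from this[of n] obtain v y where "v + y = y\<^sub>0 + real n *\<^sub>R dz"
        "agree (h T\<^sub>1 \<ominus> real n *\<^sub>R dz) (h T\<^sub>2 \<ominus> (v + y)) 2" by blast
      moreover have "real n *\<^sub>R dz = z" using n(1) by (simp add: dz_def)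
      ultimately show ?thesis by (simp add: tiling_minus_minus)
    qed
    then have "agree (h T\<^sub>1) (h T\<^sub>2 \<ominus> y\<^sub>0) r"
      by (intro agree_from_translates) (auto intro!: exI[of _ 2])
    then show ?thesis using y0(1) e(2) by force
  qed
  ultimately show ?thesis using that by blast
qed

end

section \<open>Geometry of tiles\<close>

locale finite_prototiles =
  fixes Pr :: "('a::euclidean_space, 'l) tile set set"
  assumes finite_Pr: "finite Pr"
    and prototiles: "\<forall>p\<in>Pr. prototile p"
begin

lemma prototile_cases:
  assumes "p \<in> Pr"
  obtains s where "is_tile s" "p = range (tile_minus s)"
  using assms prototiles unfolding prototile_def by blast

lemma translate_tile:
  assumes "t \<in> \<Union>Pr"
  shows "tile_minus t x \<in> \<Union>Pr"
proof -
  obtain p where p: "p \<in> Pr" "t \<in> p" using assms by blast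
  obtain s where s: "p = range (tile_minus s)" using prototile_cases[OF p(1)] by blast
  then obtain y where "t = tile_minus s y" using p(2) by blast
  then have "tile_minus t x = tile_minus s (y + x)" by (simp add: tile_minus_minus)
  then show ?thesis using p(1) s by blast
qed

lemma tile_nonempty: "t \<in> \<Union>Pr \<Longrightarrow> fst t \<noteq> {}"
  using homeomorphic_empty(1)[of "cball 0 1 :: 'a set"]
  by (auto elim!: prototile_cases simp: is_tile_def tile_minus_def)

lemma tile_compact: "t \<in> \<Union>Pr \<Longrightarrow> compact (fst t)"
  by (auto elim!: prototile_cases simp: is_tile_def tile_minus_def
      intro!: compact_continuous_image continuous_intros)

lemma tile_minus_inject: "t \<in> \<Union>Pr \<Longrightarrow> tile_minus t x = tile_minus t y \<longleftrightarrow> x = y"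
  using compact_translate_eqD[OF tile_compact tile_nonempty, of t x y]
  by (auto simp: tile_minus_def)

lemma tiling_translate: "tiling Pr T \<Longrightarrow> tiling Pr (T \<ominus> x)"
proof -
  assume T: "tiling Pr T"
  have cover: "\<exists>t\<in>T. y \<in> fst (tile_minus t x)" for y
  proof -
    have "y + x \<in> (\<Union>t\<in>T. fst t)" using T by (simp add: tiling_def)
    then obtain t where "t \<in> T" "y + x \<in> fst t" by blast
    then show ?thesis by (force simp: tile_minus_def)
  qed
  have disj: "interior (fst (tile_minus s x) \<inter> fst (tile_minus t x)) = {}"
    if "s \<in> T" "t \<in> T" "s \<noteq> t" for s t
  proof -
    have "inj (\<lambda>y. y - x)" by (simp add: inj_def)
    then have "fst (tile_minus s x) \<inter> fst (tile_minus t x) = (\<lambda>y. y - x) ` (fst s \<inter> fst t)"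
      by (simp add: tile_minus_def image_Int)
    then have "interior (fst (tile_minus s x) \<inter> fst (tile_minus t x)) =
        (\<lambda>y. y - x) ` interior (fst s \<inter> fst t)"
      using interior_translation[of "- x" "fst s \<inter> fst t"] by (simp add: image_def)
    then show ?thesis using T that by (auto simp: tiling_def pairwise_def)
  qed
  have "T \<ominus> x \<subseteq> \<Union>Pr"
    using T translate_tile unfolding tiling_def tiling_minus_def by blast
  moreover have "(\<Union>t\<in>T \<ominus> x. fst t) = UNIV"
    using cover unfolding tiling_minus_def by blast
  moreover have "pairwise (\<lambda>s t. interior (fst s \<inter> fst t) = {}) (T \<ominus> x)"
    using disj unfolding tiling_minus_def pairwise_def by blast
  ultimately show ?thesis
    unfolding tiling_def by blast
qed

lemma inradius:
  obtains \<rho> where "\<rho> > 0" "\<And>t. t \<in> \<Union>Pr \<Longrightarrow> \<exists>c. ball c \<rho> \<subseteq> fst t"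
proof -
  have "\<exists>\<rho>>0. \<forall>t\<in>p. \<exists>c. ball c \<rho> \<subseteq> fst t" if "p \<in> Pr" for p
  proof -
    obtain s where s: "is_tile s" "p = range (tile_minus s)" using prototile_cases[OF \<open>p \<in> Pr\<close>] by blast
    have "tile_minus s 0 \<in> p" unfolding s(2) by (rule rangeI)
    then have "fst s \<noteq> {}" using tile_nonempty[of s] \<open>p \<in> Pr\<close> by auto
    moreover have "closure (interior (fst s)) = fst s" using s(1) by (simp add: is_tile_def)
    ultimately have "interior (fst s) \<noteq> {}" by (metis closure_empty)
    then obtain c \<rho> where c: "\<rho> > 0" "ball c \<rho> \<subseteq> fst s" by (meson ex_in_conv mem_interior)
    have "ball (c - x) \<rho> \<subseteq> fst (tile_minus s x)" for x
    proof
      fix y assume "y \<in> ball (c - x) \<rho>"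
      then have "y + x \<in> ball c \<rho>" by (simp add: dist_norm algebra_simps)
      then have "y + x \<in> fst s" using c(2) by blast
      then have "(y + x) - x \<in> fst (tile_minus s x)" unfolding tile_minus_def fst_conv by (rule imageI)
      then show "y \<in> fst (tile_minus s x)" by simp
    qed
    then have "\<forall>t\<in>p. \<exists>c. ball c \<rho> \<subseteq> fst t" unfolding s(2) by blast
    then show ?thesis using c(1) by blast
  qed
  then have "\<forall>p\<in>Pr. \<exists>\<rho>>0. \<forall>t\<in>p. \<exists>c. ball c \<rho> \<subseteq> fst t" by blast
  from bchoice[OF this] obtain \<rho> where \<rho>: "\<And>p. p \<in> Pr \<Longrightarrow> \<rho> p > 0"
    "\<And>p t. p \<in> Pr \<Longrightarrow> t \<in> p \<Longrightarrow> \<exists>c. ball c (\<rho> p) \<subseteq> fst t" by blast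
  define m where "m = Min (insert 1 (\<rho> ` Pr))"
  have "m > 0" using finite_Pr \<rho>(1) by (simp add: m_def)
  moreover have "\<exists>c. ball c m \<subseteq> fst t" if t: "t \<in> \<Union>Pr" for t
  proof -
    obtain p where p: "p \<in> Pr" "t \<in> p" using t by blast
    have "m \<le> \<rho> p" using finite_Pr p(1) by (simp add: m_def)
    obtain c where "ball c (\<rho> p) \<subseteq> fst t" using \<rho>(2)[OF p] by blast
    then show ?thesis using subset_ball[OF \<open>m \<le> \<rho> p\<close>, of c] by blast
  qed
  ultimately show ?thesis by (rule that)
qed

lemma diameter_bound:
  obtains \<Delta> where "\<Delta> > 0" "\<And>t x y. t \<in> \<Union>Pr \<Longrightarrow> x \<in> fst t \<Longrightarrow> y \<in> fst t \<Longrightarrow> dist x y \<le> \<Delta>"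
proof -
  have "\<exists>\<Delta>. \<forall>t\<in>p. \<forall>x\<in>fst t. \<forall>y\<in>fst t. dist x y \<le> \<Delta>" if "p \<in> Pr" for p
  proof -
    obtain s where s: "is_tile s" "p = range (tile_minus s)" using prototile_cases[OF \<open>p \<in> Pr\<close>] by blast
    then have "bounded (fst s)" by (simp add: is_tile_def compact_imp_bounded)
    then obtain \<Delta> where \<Delta>: "\<forall>x\<in>fst s. \<forall>y\<in>fst s. dist x y \<le> \<Delta>"
      unfolding bounded_two_points by blast
    have "\<forall>t\<in>p. \<forall>x\<in>fst t. \<forall>y\<in>fst t. dist x y \<le> \<Delta>"
      unfolding s(2) using \<Delta> by (simp add: tile_minus_def dist_norm)
    then show ?thesis by blast
  qed
  then have "\<forall>p\<in>Pr. \<exists>\<Delta>. \<forall>t\<in>p. \<forall>x\<in>fst t. \<forall>y\<in>fst t. dist x y \<le> \<Delta>" by blast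
  from bchoice[OF this] obtain \<Delta> where \<Delta>:
    "\<And>p t x y. p \<in> Pr \<Longrightarrow> t \<in> p \<Longrightarrow> x \<in> fst t \<Longrightarrow> y \<in> fst t \<Longrightarrow> dist x y \<le> \<Delta> p" by blast
  define m where "m = Max (insert 1 (\<Delta> ` Pr))"
  have "1 \<le> m" using finite_Pr by (simp add: m_def)
  moreover have "dist x y \<le> m" if t: "t \<in> \<Union>Pr" "x \<in> fst t" "y \<in> fst t" for t x y
  proof -
    obtain p where p: "p \<in> Pr" "t \<in> p" using t by blast
    have "\<Delta> p \<le> m" using finite_Pr p(1) by (simp add: m_def)
    then show ?thesis using \<Delta>[OF p t(2,3)] by linarith
  qed
  ultimately show ?thesis using that[of m] by auto
qed

text \<open>Each tile gets a centre, in a way compatible with translations: a representative of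
  the translation class is fixed together with a centre of it, and the centre is moved along.
  Since a tile is compact, the translation from the representative is unique.\<close>

lemma tile_centres:
  obtains c \<rho> where "\<rho> > 0" "\<And>t. t \<in> \<Union>Pr \<Longrightarrow> ball (c t) \<rho> \<subseteq> fst t"
    "\<And>t x. t \<in> \<Union>Pr \<Longrightarrow> c (tile_minus t x) = c t - x"
proof -
  obtain \<rho> where \<rho>: "\<rho> > 0" "\<And>t. t \<in> \<Union>Pr \<Longrightarrow> \<exists>c. ball c \<rho> \<subseteq> fst t"
    by (rule inradius) blast
  define rep where "rep t = (SOME s. s \<in> range (tile_minus t))" for t :: "('a, 'l) tile"
  define off where "off t = (SOME x. rep t = tile_minus t x)" for t :: "('a, 'l) tile"
  define c0 where "c0 s = (SOME c. ball c \<rho> \<subseteq> fst s)" for s :: "('a, 'l) tile"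
  have off: "rep t = tile_minus t (off t)" for t
  proof -
    have "rep t \<in> range (tile_minus t)" unfolding rep_def by (rule someI[of _ "tile_minus t 0"]) blast
    then have "\<exists>x. rep t = tile_minus t x" by blast
    then show ?thesis unfolding off_def by (rule someI_ex)
  qed
  have rep: "rep (tile_minus t x) = rep t" for t x
  proof -
    have "range (tile_minus (tile_minus t x)) = range (tile_minus t)"
    proof -
      have "tile_minus t y = tile_minus (tile_minus t x) (y - x)" for y
        by (simp add: tile_minus_minus)
      then show ?thesis unfolding tile_minus_minus by blast
    qed
    then show ?thesis by (simp add: rep_def)
  qed
  define c where "c t = c0 (rep t) + off t" for t
  have "ball (c t) \<rho> \<subseteq> fst t" if t: "t \<in> \<Union>Pr" for t
  proof
    fix y assume y: "y \<in> ball (c t) \<rho>"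
    have "rep t \<in> \<Union>Pr" using translate_tile[OF t] off by metis
    from someI_ex[OF \<rho>(2)[OF this]] have "ball (c0 (rep t)) \<rho> \<subseteq> fst (rep t)"
      unfolding c0_def .
    moreover have "y - off t \<in> ball (c0 (rep t)) \<rho>"
      using y by (simp add: c_def dist_norm algebra_simps)
    ultimately have "y - off t \<in> fst (tile_minus t (off t))" using off[of t] by auto
    then show "y \<in> fst t" by (auto simp: tile_minus_def)
  qed
  moreover have "c (tile_minus t x) = c t - x" if t: "t \<in> \<Union>Pr" for t x
  proof -
    have "tile_minus t (off t) = tile_minus t (x + off (tile_minus t x))"
      using off[of t] off[of "tile_minus t x"] by (simp add: rep tile_minus_minus)
    then have "off t = x + off (tile_minus t x)" by (simp add: tile_minus_inject[OF t])
    then show ?thesis by (simp add: c_def rep algebra_simps)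
  qed
  ultimately show ?thesis by (rule that[OF \<rho>(1)])
qed

lemma close_centres_imp_eq:
  assumes T: "tiling Pr T" and st: "s \<in> T" "t \<in> T"
    and ball: "ball x \<rho> \<subseteq> fst s" "ball y \<rho> \<subseteq> fst t" and xy: "dist x y < \<rho>"
  shows "s = t"
proof (rule ccontr)
  assume "s \<noteq> t"
  have "ball x \<rho> \<inter> ball y \<rho> \<subseteq> interior (fst s \<inter> fst t)"
    using ball by (intro interior_maximal) auto
  moreover have "y \<in> ball x \<rho> \<inter> ball y \<rho>" using xy le_less_trans[OF zero_le_dist xy] by simp
  ultimately show False using T st \<open>s \<noteq> t\<close> unfolding tiling_def pairwise_def by blast
qed

text \<open>A tile at the origin and its translate by a vector shorter than the inradius overlap, so
  if both belong to one tiling, they are equal and the vector is zero.\<close>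

lemma tilings_rigid:
  assumes "\<Omega> \<subseteq> {T. tiling Pr T}"
  shows "rigid \<Omega>"
proof -
  obtain c \<rho> where c: "\<rho> > 0" "\<And>t. t \<in> \<Union>Pr \<Longrightarrow> ball (c t) \<rho> \<subseteq> fst t"
    "\<And>t x. t \<in> \<Union>Pr \<Longrightarrow> c (tile_minus t x) = c t - x"
    by (rule tile_centres) blast
  have "w = 0" if A: "A \<in> \<Omega>" and w: "norm w < \<rho>" and ag: "agree A (A \<ominus> w) 1" for A w
  proof -
    have T: "tiling Pr A" using A assms by blast
    then have "0 \<in> (\<Union>t\<in>A. fst t)" by (simp add: tiling_def)
    then obtain t where t: "t \<in> A" "0 \<in> fst t" by blast
    have tPr: "t \<in> \<Union>Pr" using T t(1) by (auto simp: tiling_def)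
    have "t \<in> A \<ominus> w"
      using agree_imp_mem[OF ag t(1)] t(2) by (metis IntI centre_in_ball empty_iff zero_less_one)
    then have "tile_minus t (- w) \<in> A" by (simp add: mem_tiling_minus)
    moreover have "ball (c t + w) \<rho> \<subseteq> fst (tile_minus t (- w))"
      using c(2)[OF translate_tile[OF tPr, of "- w"]] c(3)[OF tPr, of "- w"] by simp
    ultimately have "t = tile_minus t (- w)"
      using close_centres_imp_eq[OF T t(1) _ c(2)[OF tPr], of "tile_minus t (- w)" "c t + w"] w
      by (simp add: dist_norm)
    then show "w = 0" using tile_minus_inject[OF tPr, of 0 "- w"] by simp
  qed
  then show ?thesis using c(1) unfolding rigid_def by blast
qed

text \<open>The centres of the tiles form a pointing rule. It is local with both radii equal to \<open>1\<close>,
  since a tile whose centre is in the unit ball belongs to the patch of that ball.\<close>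

lemma pointing_rule_exists:
  assumes "\<Omega> \<subseteq> {T. tiling Pr T}"
  shows "\<exists>\<D>. local_pointing_rule \<Omega> \<D>"
proof -
  obtain c \<rho> where c: "\<rho> > 0" "\<And>t. t \<in> \<Union>Pr \<Longrightarrow> ball (c t) \<rho> \<subseteq> fst t"
    "\<And>t x. t \<in> \<Union>Pr \<Longrightarrow> c (tile_minus t x) = c t - x"
    by (rule tile_centres) blast
  obtain \<Delta> where \<Delta>: "\<Delta> > 0"
    "\<And>t x y. t \<in> \<Union>Pr \<Longrightarrow> x \<in> fst t \<Longrightarrow> y \<in> fst t \<Longrightarrow> dist x y \<le> \<Delta>"
    by (rule diameter_bound) blast
  have tPr: "t \<in> \<Union>Pr" if "T \<in> \<Omega>" "t \<in> T" for T t
    using that assms unfolding tiling_def by blast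
  have cin: "c t \<in> fst t" if "t \<in> \<Union>Pr" for t
    using c(1) c(2)[OF that] by auto
  have "Delaunay (c ` T)" if T: "T \<in> \<Omega>" for T
  proof -
    have tl: "tiling Pr T" using T assms by blast
    have "s = t" if "s \<in> T" "t \<in> T" "dist (c s) (c t) < \<rho>" for s t
      using close_centres_imp_eq[OF tl that(1,2) c(2)[OF tPr] c(2)[OF tPr] that(3)] T that by blast
    then have "uniformly_discrete (c ` T)"
      unfolding uniformly_discrete_def using c(1) by (intro exI[of _ \<rho>]) force
    moreover have "\<exists>y\<in>c ` T. dist x y \<le> \<Delta>" for x
    proof -
      have "x \<in> (\<Union>t\<in>T. fst t)" using tl by (simp add: tiling_def)
      then obtain t where "t \<in> T" "x \<in> fst t" by blast
      then show ?thesis using \<Delta>(2) cin tPr T by blast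
    qed
    ultimately show ?thesis
      unfolding Delaunay_def relatively_dense_def using \<Delta>(1) by blast
  qed
  moreover have "c ` (T \<ominus> x) = (\<lambda>y. y - x) ` c ` T" if "T \<in> \<Omega>" for T x
    unfolding tiling_minus_def image_image using c(3) tPr[OF that] by (intro image_cong) auto
  moreover have "c ` T \<inter> ball 0 1 \<subseteq> c ` T'" if "T \<in> \<Omega>" "patch T 0 1 = patch T' 0 1" for T T'
  proof
    fix y assume "y \<in> c ` T \<inter> ball 0 1"
    then obtain t where t: "t \<in> T" "y = c t" "c t \<in> ball 0 1" by blast
    then have "c t \<in> fst t \<inter> ball 0 1" using cin[OF tPr[OF that(1) t(1)]] by blast
    then have "t \<in> patch T 0 1" using t(1) unfolding patch_def by blast
    then have "t \<in> T'" using that(2) unfolding patch_def by blast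
    then show "y \<in> c ` T'" using t(2) by blast
  qed
  then have "\<forall>T\<in>\<Omega>. \<forall>T'\<in>\<Omega>. patch T 0 1 = patch T' 0 1 \<longrightarrow> c ` T \<inter> ball 0 1 = c ` T' \<inter> ball 0 1"
    by (intro ballI impI equalityI Int_greatest Int_lower2) simp_all
  then have "\<exists>\<rho>>0. \<exists>R>0. \<forall>T\<in>\<Omega>. \<forall>T'\<in>\<Omega>.
      patch T 0 R = patch T' 0 R \<longrightarrow> c ` T \<inter> ball 0 \<rho> = c ` T' \<inter> ball 0 \<rho>"
    by (intro exI[of _ "1 :: real"] conjI zero_less_one)
  ultimately have "local_pointing_rule \<Omega> (\<lambda>T. c ` T)"
    unfolding local_pointing_rule_def by (intro conjI ballI allI)
  then show ?thesis by blast
qed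

end

section \<open>Hulls of tilings of finite local complexity\<close>

context finite_prototiles
begin

text \<open>The patches stabilise, so their union is a tiling: any two of its tiles, and a tile covering
  any given point, can already be found in one of the tilings.\<close>

lemma limit_of_agreeing_tilings:
  assumes T: "\<And>k. tiling Pr (A k)" and ag: "\<And>k. agree (A k) (A (Suc k)) (r k)"
    and r: "mono r" "filterlim r at_top sequentially"
  obtains B where "tiling Pr B" "\<And>k. agree B (A k) (r k)"
proof -
  have agm: "agree (A k) (A m) (r k)" if "k \<le> m" for k m
    using that
  proof (induction m rule: dec_induct)
    case (step m)
    then show ?case using agree_trans[OF _ agree_mono[OF ag]] monoD[OF r(1)] by blast
  qed simp
  define B where "B = (\<Union>k. patch (A k) 0 (r k))"
  have B: "t \<in> B \<longleftrightarrow> t \<in> A k" if t: "fst t \<inter> ball 0 (r k) \<noteq> {}" for t k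
  proof
    assume "t \<in> B"
    then obtain m where m: "t \<in> A m" "fst t \<inter> ball 0 (r m) \<noteq> {}" by (auto simp: B_def patch_def)
    show "t \<in> A k"
    proof (cases "k \<le> m")
      case True
      then show ?thesis using agree_imp_mem[OF agree_sym[OF agm[OF True]] m(1) t] by blast
    next
      case False
      then show ?thesis using agree_imp_mem[OF agm[of m k] m] by simp
    qed
  next
    assume "t \<in> A k"
    then show "t \<in> B" using t by (auto simp: B_def patch_def)
  qed
  have large: "\<exists>k. x < r k" for x
    using filterlim_at_top_dense[of r sequentially] r(2) by (meson eventually_sequentially order_refl)
  have common: "\<exists>k. s \<in> A k \<and> t \<in> A k" if "s \<in> B" "t \<in> B" for s t
  proof -
    obtain i j where "s \<in> patch (A i) 0 (r i)" "t \<in> patch (A j) 0 (r j)"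
      using \<open>s \<in> B\<close> \<open>t \<in> B\<close> by (auto simp: B_def)
    then have "s \<in> A (max i j)" "t \<in> A (max i j)"
      using agree_imp_mem[OF agm[of i "max i j"], of s] agree_imp_mem[OF agm[of j "max i j"], of t]
      by (auto simp: patch_def)
    then show ?thesis by blast
  qed
  have "B \<subseteq> \<Union>Pr" using T unfolding B_def patch_def tiling_def by blast
  moreover have "y \<in> (\<Union>t\<in>B. fst t)" for y
  proof -
    obtain k where k: "norm y < r k" using large by blast
    have "y \<in> (\<Union>t\<in>A k. fst t)" using T[of k] by (simp add: tiling_def)
    then obtain t where t: "t \<in> A k" "y \<in> fst t" by blast
    then have "t \<in> B" using k B[of t k] by (metis IntI empty_iff mem_ball_0)
    then show ?thesis using t(2) by blast
  qed
  then have "(\<Union>t\<in>B. fst t) = UNIV" by blast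
  moreover have "pairwise (\<lambda>s t. interior (fst s \<inter> fst t) = {}) B"
  proof (rule pairwiseI)
    fix s t assume st: "s \<in> B" "t \<in> B" "s \<noteq> t"
    obtain k where "s \<in> A k" "t \<in> A k" using common[OF st(1,2)] by blast
    then show "interior (fst s \<inter> fst t) = {}"
      using T[of k] st(3) unfolding tiling_def pairwise_def by blast
  qed
  ultimately have "tiling Pr B" unfolding tiling_def by blast
  moreover have "agree B (A k) (r k)" for k using B by (intro agreeI) blast
  ultimately show ?thesis by (rule that)
qed

lemma Metric_tilings: "Metric_space {T. tiling Pr T} tiling_dist"
  by (rule Metric_space_tilings[OF prototiles])

text \<open>From a Cauchy sequence one extracts a subsequence whose successive terms agree, after
  translations with summable norms, on balls of radii tending to infinity. Correcting by the
  partial sums of these translations gives tilings that agree exactly.\<close>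

lemma tilings_mcomplete: "Metric_space.mcomplete {T. tiling Pr T} tiling_dist"
proof -
  interpret M: Metric_space "{T. tiling Pr T}" tiling_dist by (rule Metric_tilings)
  have "\<exists>B. limitin M.mtopology \<sigma> B sequentially" if \<sigma>: "M.MCauchy \<sigma>" for \<sigma>
  proof -
    have \<sigma>T: "tiling Pr (\<sigma> n)" for n using \<sigma> unfolding M.MCauchy_def by blast
    define e :: "nat \<Rightarrow> real" where "e k = (1 / 2) ^ (k + 2)" for k
    have e: "e k > 0" "e k \<le> 1 / 4" "2 * e k = (1 / 2) ^ Suc k" "1 / e k = 4 * 2 ^ k" for k
      using power_decreasing[of 2 "k + 2" "1 / 2 :: real"]
      by (auto simp: e_def power_divide power_add field_simps)
    have "\<forall>k. \<exists>N. \<forall>m n. N \<le> m \<longrightarrow> N \<le> n \<longrightarrow> tiling_dist (\<sigma> m) (\<sigma> n) < e k"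
      using \<sigma> e(1) unfolding M.MCauchy_def by blast
    then obtain N where N: "\<And>k m n. N k \<le> m \<Longrightarrow> N k \<le> n \<Longrightarrow> tiling_dist (\<sigma> m) (\<sigma> n) < e k"
      by metis
    \<comment> \<open>The summand \<open>k\<close> and the sum, in place of \<open>N k\<close> alone, make \<open>q\<close> strictly increasing.\<close>
    define q where "q k = k + (\<Sum>i\<le>k. N i)" for k
    have q: "strict_mono q" by (simp add: strict_mono_Suc_iff q_def)
    have Nq: "N k \<le> q k" for k
      using member_le_sum[of k "{..k}" N] by (simp add: q_def)
    have "\<exists>w. norm w < 2 * e k \<and> agree (\<sigma> (q k)) (\<sigma> (q (Suc k)) \<ominus> w) (1 / e k - e k)" for k
    proof -
      have "q k \<le> q (Suc k)" using strict_monoD[OF q, of k "Suc k"] by simp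
      then have "tiling_dist (\<sigma> (q k)) (\<sigma> (q (Suc k))) < e k"
        using N Nq le_trans by blast
      moreover have "e k \<le> 1 / sqrt 2" using e(2)[of k] inverse_sqrt2_ge_half by linarith
      ultimately show ?thesis by (rule dist_small_imp_agree) blast
    qed
    then obtain w where w: "\<And>k. norm (w k) < 2 * e k"
      "\<And>k. agree (\<sigma> (q k)) (\<sigma> (q (Suc k)) \<ominus> w k) (1 / e k - e k)" by metis
    have geo: "(\<Sum>i<k. (1 / 2 :: real) ^ Suc i) \<le> 1" for k
    proof -
      have "(\<Sum>i<k. (1 / 2 :: real) ^ Suc i) = 1 - (1 / 2) ^ k" by (induction k) simp_all
      then show ?thesis by simp
    qed
    have wle: "norm (w k) \<le> (1 / 2) ^ Suc k" for k using w(1)[of k] e(3)[of k] by simp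
    have "summable (\<lambda>k. (1 / 2 :: real) ^ Suc k)"
      by (simp add: summable_geometric summable_mult)
    then have "summable w" by (rule summable_comparison_test') (use wle in auto)
    have pow: "filterlim (\<lambda>k. (2 :: real) ^ k) at_top sequentially"
      using filterlim_realpow_sequentially_gt1[of "2 :: real"]
      by (simp add: filterlim_at_infinity_imp_filterlim_at_top)
    define s where "s k = (\<Sum>i<k. w i)" for k
    have s1: "norm (s k) \<le> 1" for k
    proof -
      have "norm (s k) \<le> (\<Sum>i<k. (1 / 2 :: real) ^ Suc i)"
        unfolding s_def by (rule sum_norm_le) (use wle in auto)
      then show ?thesis using geo[of k] by linarith
    qed
    have lim: "s \<longlonglongrightarrow> suminf w" unfolding s_def using summable_LIMSEQ[OF \<open>summable w\<close>] .
    have "agree (\<sigma> (q k) \<ominus> s k) (\<sigma> (q (Suc k)) \<ominus> s (Suc k)) (2 ^ k)" for k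
    proof -
      have "norm (s k) + 2 ^ k \<le> 1 / e k - e k"
      proof -
        have "1 \<le> (2 :: real) ^ k" by simp
        then show ?thesis using s1[of k] e(2)[of k] unfolding e(4) by linarith
      qed
      from agree_shift[OF w(2) this]
      show ?thesis by (simp add: tiling_minus_minus s_def add.commute)
    qed
    then obtain B where B: "tiling Pr B" "\<And>k. agree B (\<sigma> (q k) \<ominus> s k) (2 ^ k)"
    proof (rule limit_of_agreeing_tilings[of "\<lambda>k. \<sigma> (q k) \<ominus> s k", rotated])
      show "mono (\<lambda>k. (2 :: real) ^ k)" by (simp add: mono_def power_increasing)
      show "filterlim (\<lambda>k. (2 :: real) ^ k) at_top sequentially" by (rule pow)
      show "tiling Pr (\<sigma> (q k) \<ominus> s k)" for k using tiling_translate \<sigma>T by blast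
    qed blast
    \<comment> \<open>The corrections \<open>s k\<close> tend to \<open>suminf w\<close>; undoing \<open>suminf w\<close> turns the limit \<open>B\<close> of the
      corrected tilings into the limit of the original ones.\<close>
    define S where "S = B \<ominus> - suminf w"
    have S: "tiling Pr S" unfolding S_def using tiling_translate B(1) by blast
    have "limitin M.mtopology (\<sigma> \<circ> q) S sequentially"
      unfolding M.limitin_metric
    proof (intro conjI allI impI)
      fix \<epsilon> :: real assume \<epsilon>: "\<epsilon> > 0"
      have "\<forall>\<^sub>F k in sequentially. dist (s k) (suminf w) < \<epsilon> / 2"
        by (rule tendstoD[OF lim half_gt_zero[OF \<epsilon>]])
      moreover have "\<forall>\<^sub>F k in sequentially. 2 / \<epsilon> + 1 \<le> 2 ^ k"
        using pow unfolding filterlim_at_top by blast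
      ultimately show "\<forall>\<^sub>F k in sequentially. (\<sigma> \<circ> q) k \<in> {T. tiling Pr T} \<and> tiling_dist ((\<sigma> \<circ> q) k) S < \<epsilon>"
      proof eventually_elim
        case (elim k)
        have "agree (\<sigma> (q k) \<ominus> s k \<ominus> - s k) (B \<ominus> - s k) (2 ^ k - 1)"
          using s1[of k] by (intro agree_shift[OF agree_sym[OF B(2)]]) simp
        then have "agree (\<sigma> (q k)) (S \<ominus> (suminf w - s k)) (2 ^ k - 1)"
          by (simp add: tiling_minus_minus S_def)
        then have "tiling_dist (\<sigma> (q k)) S \<le> \<epsilon> / 2"
          using elim \<epsilon> by (intro agree_imp_dist_le) (auto simp: dist_norm norm_minus_commute)
        then show ?case using \<epsilon> \<sigma>T by simp
      qed
    qed (use S in simp)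
    then show ?thesis using M.MCauchy_convergent_subsequence[OF \<sigma> q] by blast
  qed
  then show ?thesis unfolding M.mcomplete_def by blast
qed

end

locale flc_tiling = finite_prototiles Pr
  for Pr :: "('a::euclidean_space, 'l) tile set set" +
  fixes T
  assumes tiling: "tiling Pr T" and flc: "finite_local_complexity T"
begin

abbreviation hull ("\<Omega>") where "\<Omega> \<equiv> tiling_hull Pr T"

text \<open>In the closure of an orbit of \<open>T\<close> the small translation allowed by the distance can be
  absorbed into the orbit, which leaves exact agreement on balls.\<close>

lemma hull_iff: "S \<in> \<Omega> \<longleftrightarrow> tiling Pr S \<and> (\<forall>L. \<exists>x. agree S (T \<ominus> x) L)"
proof -
  interpret M: Metric_space "{T. tiling Pr T}" tiling_dist by (rule Metric_tilings)
  have cl: "S \<in> \<Omega> \<longleftrightarrow> tiling Pr S \<and> (\<forall>r>0. \<exists>x. tiling_dist S (T \<ominus> x) < r)"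
    unfolding tiling_hull_def M.metric_closure_of using tiling_translate[OF tiling]
    by (auto simp: M.in_mball)
  have "\<exists>x. agree S (T \<ominus> x) L" if "\<forall>r>0. \<exists>x. tiling_dist S (T \<ominus> x) < r" for L
  proof -
    define e where "e = min (1 / 2) (1 / (\<bar>L\<bar> + 1))"
    have e: "0 < e" "e \<le> 1 / 2" "e \<le> 1 / (\<bar>L\<bar> + 1)"
      unfolding e_def by (auto simp: add_nonneg_pos)
    have "e * (\<bar>L\<bar> + 1) \<le> 1" using e(3) by (simp add: field_simps)
    then have "\<bar>L\<bar> + 1 \<le> 1 / e" using e(1) by (simp add: field_simps)
    then have Le: "L \<le> 1 / e - e" using e(2) by linarith
    obtain x where "tiling_dist S (T \<ominus> x) < e"
      using \<open>\<forall>r>0. \<exists>x. tiling_dist S (T \<ominus> x) < r\<close> e(1) by blast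
    moreover have "e \<le> 1 / sqrt 2" using e(2) inverse_sqrt2_ge_half by linarith
    ultimately obtain u where "agree S (T \<ominus> x \<ominus> u) (1 / e - e)"
      by (rule dist_small_imp_agree) blast
    then show ?thesis using Le agree_mono tiling_minus_minus by metis
  qed
  moreover have "\<exists>x. tiling_dist S (T \<ominus> x) < r" if "\<forall>L. \<exists>x. agree S (T \<ominus> x) L" "r > 0" for r
  proof -
    obtain x where "agree S (T \<ominus> x) (2 / r)" using \<open>\<forall>L. \<exists>x. agree S (T \<ominus> x) L\<close> by blast
    then have "tiling_dist S (T \<ominus> x) \<le> r / 2"
      using that(2) by (intro agree_imp_dist_le[of S "T \<ominus> x" 0 "2 / r"]) auto
    then show ?thesis using that(2) by (intro exI[of _ x]) simp
  qed
  ultimately show ?thesis unfolding cl by blast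
qed

lemma hull_subset: "\<Omega> \<subseteq> {T. tiling Pr T}"
  by (auto simp: hull_iff)

lemma hull_invariant: "S \<in> \<Omega> \<Longrightarrow> S \<ominus> y \<in> \<Omega>"
proof -
  assume S: "S \<in> \<Omega>"
  have "\<exists>x. agree (S \<ominus> y) (T \<ominus> x) L" for L
  proof -
    obtain x where "agree S (T \<ominus> x) (norm y + L)" using S by (auto simp: hull_iff)
    then have "agree (S \<ominus> y) (T \<ominus> x \<ominus> y) L" by (rule agree_shift) simp
    then show ?thesis unfolding tiling_minus_minus by blast
  qed
  then show ?thesis using S tiling_translate by (auto simp: hull_iff)
qed

lemma hull_nonempty_tiles: "S \<in> \<Omega> \<Longrightarrow> t \<in> S \<Longrightarrow> fst t \<noteq> {}"
  using tile_nonempty hull_subset unfolding tiling_def by blast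

lemma base_in_hull: "T \<in> \<Omega>"
  unfolding hull_iff using tiling by (auto intro!: exI[of _ 0])

text \<open>By finite local complexity the patch of \<open>T\<close> of a given radius at a given point is,
  up to a translation, one of finitely many, and the translation can be taken bounded since
  tiles are. A finite net of translations then gives a finite net for the orbit.\<close>

lemma orbit_totally_bounded:
  "Metric_space.mtotally_bounded {T. tiling Pr T} tiling_dist (range ((\<ominus>) T))"
proof -
  interpret M: Metric_space "{T. tiling Pr T}" tiling_dist by (rule Metric_tilings)
  obtain \<Delta> where \<Delta>: "\<Delta> > 0" "\<And>t x y. t \<in> \<Union>Pr \<Longrightarrow> x \<in> fst t \<Longrightarrow> y \<in> fst t \<Longrightarrow> dist x y \<le> \<Delta>"
    by (rule diameter_bound) blast
  have "\<exists>K. finite K \<and> K \<subseteq> range ((\<ominus>) T) \<and> range ((\<ominus>) T) \<subseteq> (\<Union>x\<in>K. M.mball x \<epsilon>)"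
    if \<epsilon>: "\<epsilon> > 0" for \<epsilon>
  proof -
    define e where "e = \<epsilon> / 2"
    \<comment> \<open>Two tilings with the same patch up to a translation of norm at most \<open>e\<close> agree, after
      that translation, on the ball of radius \<open>R - e\<close>.\<close>
    define R where "R = 1 / e + e"
    have e: "e > 0" "e < \<epsilon>" using \<epsilon> by (auto simp: e_def)
    have R: "R > 0" "1 / e \<le> R - e" using e(1) by (auto simp: R_def add_pos_pos)
    define cls where "cls x = range (tiling_minus (patch T x R))" for x
    have fin: "finite (range cls)"
    proof -
      have "finite {cls x | x. x \<in> UNIV}"
        using flc R(1) by (simp add: finite_local_complexity_def cls_def)
      then show ?thesis unfolding Setcompr_eq_image .
    qed
    define b where "b q = (SOME x. cls x = q)" for q
    have b: "cls (b (cls x)) = cls x" for x unfolding b_def by (rule someI) (rule refl)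
    have "\<exists>w. norm w \<le> R + \<Delta> \<and> patch (T \<ominus> x) 0 R = patch (T \<ominus> b (cls x)) 0 R \<ominus> w" for x
    proof -
      define p where "p = b (cls x)"
      have "patch T x R \<ominus> 0 \<in> cls p" unfolding p_def b unfolding cls_def by (rule rangeI)
      then obtain y where y: "patch T x R = patch T p R \<ominus> y" by (auto simp: cls_def)
      define w where "w = x + y - p"
      have w: "patch (T \<ominus> x) 0 R = patch (T \<ominus> p) 0 R \<ominus> w"
        unfolding patch_tiling_minus by (simp add: y tiling_minus_minus w_def algebra_simps)
      \<comment> \<open>A tile of the first patch containing the origin is moved to one that meets the ball of
        radius \<open>R\<close>, which bounds the translation.\<close>
      have tp: "tiling Pr (T \<ominus> p)" using tiling_translate tiling by blast
      then have "0 \<in> (\<Union>t\<in>T \<ominus> p. fst t)" by (simp add: tiling_def)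
      then obtain t where t: "t \<in> T \<ominus> p" "0 \<in> fst t" by blast
      then have "t \<in> patch (T \<ominus> p) 0 R" using R(1) by (auto simp: patch_def)
      then have "tile_minus t w \<in> patch (T \<ominus> x) 0 R" unfolding w by (simp add: tiling_minus_def)
      then obtain z where "z \<in> fst t" "norm (z - w) < R" by (auto simp: patch_def tile_minus_def)
      moreover have "dist z 0 \<le> \<Delta>"
        using \<Delta>(2)[of t z 0] t tp \<open>z \<in> fst t\<close> unfolding tiling_def by blast
      ultimately have "norm w \<le> R + \<Delta>"
        using norm_triangle_ineq4[of z "z - w"] by simp
      then show ?thesis using w unfolding p_def by blast
    qed
    then obtain w where w: "\<And>x. norm (w x) \<le> R + \<Delta>"
      "\<And>x. patch (T \<ominus> x) 0 R = patch (T \<ominus> b (cls x)) 0 R \<ominus> w x" by metis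
    have "\<forall>d>0. \<exists>F. finite F \<and> cball (0 :: 'a) (R + \<Delta>) \<subseteq> (\<Union>c\<in>F. ball c d)"
      using compact_cball[of "0 :: 'a" "R + \<Delta>"] unfolding compact_eq_totally_bounded by (rule conjunct2)
    from this[rule_format, OF half_gt_zero[OF e(1)]]
    obtain F where F: "finite F" "cball (0 :: 'a) (R + \<Delta>) \<subseteq> (\<Union>c\<in>F. ball c (e / 2))"
      by (elim exE conjE)
    have "\<forall>x. \<exists>c. c \<in> F \<and> dist c (w x) < e / 2"
    proof
      fix x
      have "w x \<in> (\<Union>c\<in>F. ball c (e / 2))" using w(1)[of x] F(2) by (auto simp del: mem_ball)
      then show "\<exists>c. c \<in> F \<and> dist c (w x) < e / 2" by auto
    qed
    from choice[OF this] obtain c where c: "\<And>x. c x \<in> F" "\<And>x. dist (c x) (w x) < e / 2"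
      by blast
    define f where "f x = (cls x, c x)" for x
    have "range f \<subseteq> range cls \<times> F" using c(1) by (auto simp: f_def)
    then have finf: "finite (range f)" using fin F(1) by (meson finite_SigmaI finite_subset)
    define g where "g v = (SOME x. f x = v)" for v
    have g: "f (g (f x)) = f x" for x unfolding g_def by (rule someI) (rule refl)
    have near: "tiling_dist (T \<ominus> g (f x)) (T \<ominus> x) \<le> e" for x
    proof -
      define x' where "x' = g (f x)"
      have eq: "cls x' = cls x" "c x' = c x" using g[of x] by (auto simp: f_def x'_def)
      define v where "v = w x' - w x"
      have v: "norm v \<le> e"
      proof -
        have "dist (w x') (w x) \<le> dist (c x) (w x') + dist (c x) (w x)"
          by (rule dist_triangle3)
        then show ?thesis using c(2)[of x] c(2)[of x'] eq(2) by (simp add: v_def dist_norm)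
      qed
      have P: "patch (T \<ominus> x') 0 R = patch (T \<ominus> x) 0 R \<ominus> v"
        unfolding w(2)[of x] w(2)[of x'] eq(1) by (simp add: tiling_minus_minus v_def)
      have "patch (T \<ominus> x') 0 R = patch (T \<ominus> x \<ominus> v) (- v) R"
        unfolding P by (simp add: patch_tiling_minus)
      then have "patch (T \<ominus> x') 0 (R - e) = patch (T \<ominus> x \<ominus> v) 0 (R - e)"
      proof -
        have sub: "ball 0 (R - e) \<subseteq> ball 0 R" "ball 0 (R - e) \<subseteq> ball (- v) R"
          using e(1) v by (auto simp: ball_subset_ball_iff dist_norm)
        have "patch C 0 (R - e) = {t \<in> patch C u R. fst t \<inter> ball 0 (R - e) \<noteq> {}}"
          if "ball 0 (R - e) \<subseteq> ball u R" for C :: "('a, 'l) tiling" and u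
          using that unfolding patch_def by blast
        from this[OF sub(1), of "T \<ominus> x'"] this[OF sub(2), of "T \<ominus> x \<ominus> v"]
        show ?thesis
          using \<open>patch (T \<ominus> x') 0 R = patch (T \<ominus> x \<ominus> v) (- v) R\<close> by simp
      qed
      then have "agree (T \<ominus> x') (T \<ominus> x \<ominus> v) (R - e)" by (simp add: agree_def)
      then show ?thesis unfolding x'_def using v e(1) R(2) by (rule agree_imp_dist_le)
    qed
    show ?thesis
    proof (intro exI conjI)
      show "finite ((\<lambda>v. T \<ominus> g v) ` range f)" using finf by (rule finite_imageI)
      show "(\<lambda>v. T \<ominus> g v) ` range f \<subseteq> range ((\<ominus>) T)" by blast
      have "T \<ominus> x \<in> M.mball (T \<ominus> g (f x)) \<epsilon>" for x
        using near[of x] e(2) tiling_translate[OF tiling] by (simp add: M.in_mball)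
      then show "range ((\<ominus>) T) \<subseteq> (\<Union>S\<in>(\<lambda>v. T \<ominus> g v) ` range f. M.mball S \<epsilon>)" by blast
    qed
  qed
  then show ?thesis unfolding M.mtotally_bounded_def by blast
qed

lemma hull_metric: "Metric_space \<Omega> tiling_dist"
  by (rule Metric_space_tiling_hull[OF prototiles])

lemma hull_compact: "compact_space (space_topology \<Omega>)"
proof -
  interpret M: Metric_space "{T. tiling Pr T}" tiling_dist by (rule Metric_tilings)
  interpret S: Submetric "{T. tiling Pr T}" tiling_dist \<Omega>
    by unfold_locales (rule hull_subset)
  have "compactin M.mtopology \<Omega>"
    using M.mtotally_bounded_eq_compact_closure_of[OF tilings_mcomplete] orbit_totally_bounded
    unfolding tiling_hull_def by blast
  then show ?thesis
    unfolding space_topology_def S.mtopology_submetric compactin_subspace by blast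
qed

end

lemma continuous_map_imp_patch_continuous:
  assumes "flc_tiling Pr T" "flc_tiling Pr' T'"
    and h: "continuous_map (space_topology (tiling_hull Pr T)) (space_topology (tiling_hull Pr' T')) h"
  shows "patch_continuous (tiling_hull Pr T) h"
proof -
  let ?A = "tiling_hull Pr T" and ?B = "tiling_hull Pr' T'"
  interpret A: Metric_space ?A tiling_dist by (rule flc_tiling.hull_metric[OF assms(1)])
  interpret B: Metric_space ?B tiling_dist by (rule flc_tiling.hull_metric[OF assms(2)])
  have "uniformly_continuous_map (metric (?A, tiling_dist)) (metric (?B, tiling_dist)) h"
    using h flc_tiling.hull_compact[OF assms(1)] unfolding space_topology_def
    by (intro continuous_imp_uniformly_continuous_map) (simp add: mtopology_of_def)
  then have "\<forall>\<epsilon>>0. \<exists>\<delta>>0. \<forall>x\<in>?A. \<forall>y\<in>?A. tiling_dist y x < \<delta> \<longrightarrow> tiling_dist (h y) (h x) < \<epsilon>"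
    by (simp add: uniformly_continuous_map_def)
  then show ?thesis by (intro uniformly_continuous_imp_patch_continuous) meson
qed

section \<open>Pointing rules\<close>

context flc_tiling
begin

context
  fixes \<D>
  assumes rule: "local_pointing_rule \<Omega> \<D>"
begin

lemma point_iff_origin: "S \<in> \<Omega> \<Longrightarrow> p \<in> \<D> S \<longleftrightarrow> 0 \<in> \<D> (S \<ominus> p)"
proof -
  assume "S \<in> \<Omega>"
  then have "\<D> (S \<ominus> p) = (\<lambda>y. y - p) ` \<D> S"
    using rule unfolding local_pointing_rule_def by blast
  then show ?thesis by force
qed

text \<open>The rule compares patterns on one small ball only. Translating this ball to each point
  of a ball of any radius \<open>r\<close> enlarges the patch needed by the same constant \<open>R\<close>.\<close>

lemma points_local:
  obtains R where "R > 0"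
    "\<And>S\<^sub>1 S\<^sub>2 r p. S\<^sub>1 \<in> \<Omega> \<Longrightarrow> S\<^sub>2 \<in> \<Omega> \<Longrightarrow> agree S\<^sub>1 S\<^sub>2 (r + R) \<Longrightarrow> norm p \<le> r \<Longrightarrow>
      p \<in> \<D> S\<^sub>1 \<longleftrightarrow> p \<in> \<D> S\<^sub>2"
proof -
  obtain \<rho> R where R: "\<rho> > 0" "R > 0" "\<forall>S\<^sub>1\<in>\<Omega>. \<forall>S\<^sub>2\<in>\<Omega>.
      patch S\<^sub>1 0 R = patch S\<^sub>2 0 R \<longrightarrow> \<D> S\<^sub>1 \<inter> ball 0 \<rho> = \<D> S\<^sub>2 \<inter> ball 0 \<rho>"
    using rule unfolding local_pointing_rule_def by blast
  have "p \<in> \<D> S\<^sub>1 \<longleftrightarrow> p \<in> \<D> S\<^sub>2"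
    if S: "S\<^sub>1 \<in> \<Omega>" "S\<^sub>2 \<in> \<Omega>" and ag: "agree S\<^sub>1 S\<^sub>2 (r + R)" and p: "norm p \<le> r" for S\<^sub>1 S\<^sub>2 r p
  proof -
    have "agree (S\<^sub>1 \<ominus> p) (S\<^sub>2 \<ominus> p) R" using p by (intro agree_shift[OF ag]) simp
    then have "\<D> (S\<^sub>1 \<ominus> p) \<inter> ball 0 \<rho> = \<D> (S\<^sub>2 \<ominus> p) \<inter> ball 0 \<rho>"
      using R(3) S hull_invariant unfolding agree_def by blast
    then have "0 \<in> \<D> (S\<^sub>1 \<ominus> p) \<longleftrightarrow> 0 \<in> \<D> (S\<^sub>2 \<ominus> p)"
      using centre_in_ball[of 0 \<rho>] R(1) by blast
    then show ?thesis using point_iff_origin S by simp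
  qed
  then show ?thesis by (rule that[OF R(2)])
qed

text \<open>Every tiling of the hull agrees on any given ball with a translate of \<open>T\<close>, so the
  Delaunay constants of the pattern of \<open>T\<close> hold throughout the hull.\<close>

lemma points_copied:
  assumes S: "S \<in> \<Omega>"
  obtains x where "\<And>p. norm p \<le> r \<Longrightarrow> p \<in> \<D> S \<longleftrightarrow> p + x \<in> \<D> T"
proof -
  obtain R where R: "R > 0"
    "\<And>S\<^sub>1 S\<^sub>2 r p. S\<^sub>1 \<in> \<Omega> \<Longrightarrow> S\<^sub>2 \<in> \<Omega> \<Longrightarrow> agree S\<^sub>1 S\<^sub>2 (r + R) \<Longrightarrow> norm p \<le> r \<Longrightarrow>
      p \<in> \<D> S\<^sub>1 \<longleftrightarrow> p \<in> \<D> S\<^sub>2"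
    by (rule points_local) blast
  obtain x where x: "agree S (T \<ominus> x) (r + R)" using S by (auto simp: hull_iff)
  have "p \<in> \<D> S \<longleftrightarrow> p + x \<in> \<D> T" if "norm p \<le> r" for p
  proof -
    have "p \<in> \<D> S \<longleftrightarrow> p \<in> \<D> (T \<ominus> x)"
      by (rule R(2)[OF S hull_invariant[OF base_in_hull] x that])
    also have "\<dots> \<longleftrightarrow> 0 \<in> \<D> (T \<ominus> (p + x))"
      using point_iff_origin[OF hull_invariant[OF base_in_hull], of p x]
      by (simp add: tiling_minus_minus add.commute)
    also have "\<dots> \<longleftrightarrow> p + x \<in> \<D> T" using point_iff_origin[OF base_in_hull] by simp
    finally show ?thesis .
  qed
  then show ?thesis by (rule that)
qed

lemma points_uniformly_dense:
  obtains R where "R > 0" "\<And>S. S \<in> \<Omega> \<Longrightarrow> \<exists>p\<in>\<D> S. norm p \<le> R"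
proof -
  have "relatively_dense (\<D> T)"
    using rule base_in_hull unfolding local_pointing_rule_def Delaunay_def by blast
  then obtain R where R: "R > 0" "\<And>x. \<exists>y\<in>\<D> T. dist x y \<le> R"
    unfolding relatively_dense_def by blast
  have "\<exists>p\<in>\<D> S. norm p \<le> R" if S: "S \<in> \<Omega>" for S
  proof -
    obtain x where x: "\<And>p. norm p \<le> R \<Longrightarrow> p \<in> \<D> S \<longleftrightarrow> p + x \<in> \<D> T"
      by (rule points_copied[OF S]) blast
    obtain y where "y \<in> \<D> T" "dist x y \<le> R" using R(2) by blast
    then have "norm (y - x) \<le> R" "y - x \<in> \<D> S"
      using x[of "y - x"] by (auto simp: dist_norm norm_minus_commute)
    then show ?thesis by blast
  qed
  then show ?thesis by (rule that[OF R(1)])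
qed

text \<open>Points are \<open>r\<close> apart, so each ball of a finite cover by balls of radius \<open>r / 2\<close> contains
  at most one of them; the cover depends on \<open>W\<close> and \<open>r\<close> but not on the tiling.\<close>

lemma points_uniformly_few:
  obtains M where "\<And>S. S \<in> \<Omega> \<Longrightarrow> finite {p \<in> \<D> S. norm p \<le> W} \<and> card {p \<in> \<D> S. norm p \<le> W} \<le> M"
proof -
  have "uniformly_discrete (\<D> T)"
    using rule base_in_hull unfolding local_pointing_rule_def Delaunay_def by blast
  then obtain r where r: "r > 0" "\<And>x y. x \<in> \<D> T \<Longrightarrow> y \<in> \<D> T \<Longrightarrow> x \<noteq> y \<Longrightarrow> r \<le> dist x y"
    unfolding uniformly_discrete_def by blast
  have "\<forall>d>0. \<exists>F. finite F \<and> cball (0 :: 'a) W \<subseteq> (\<Union>c\<in>F. ball c d)"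
    using compact_cball[of "0 :: 'a" W] unfolding compact_eq_totally_bounded by (rule conjunct2)
  from this[rule_format, OF half_gt_zero[OF r(1)]]
  obtain F where F: "finite F" "cball (0 :: 'a) W \<subseteq> (\<Union>c\<in>F. ball c (r / 2))"
    by (elim exE conjE)
  have "finite {p \<in> \<D> S. norm p \<le> W} \<and> card {p \<in> \<D> S. norm p \<le> W} \<le> card F" if S: "S \<in> \<Omega>" for S
  proof -
    let ?P = "{p \<in> \<D> S. norm p \<le> W}"
    obtain x where x: "\<And>p. norm p \<le> W \<Longrightarrow> p \<in> \<D> S \<longleftrightarrow> p + x \<in> \<D> T"
      by (rule points_copied[OF S]) blast
    have "\<forall>p\<in>?P. \<exists>c. c \<in> F \<and> dist c p < r / 2"
    proof
      fix p assume "p \<in> ?P"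
      then have "p \<in> (\<Union>c\<in>F. ball c (r / 2))" using F(2) by (auto simp del: mem_ball)
      then show "\<exists>c. c \<in> F \<and> dist c p < r / 2" by auto
    qed
    from bchoice[OF this] obtain c where c: "\<forall>p\<in>?P. c p \<in> F \<and> dist (c p) p < r / 2" ..
    have "inj_on c ?P"
    proof (rule inj_onI)
      fix p q assume pq: "p \<in> ?P" "q \<in> ?P" "c p = c q"
      have "dist p q \<le> dist (c p) p + dist (c p) q" by (rule dist_triangle3)
      also have "\<dots> < r"
        using bspec[OF c pq(1)] bspec[OF c pq(2)] unfolding pq(3) by linarith
      finally have "dist (p + x) (q + x) < r" by simp
      then show "p = q" using r(2)[of "p + x" "q + x"] x pq by force
    qed
    moreover have "c ` ?P \<subseteq> F" using c by blast
    ultimately show ?thesis using F(1) inj_on_finite card_inj_on_le by blast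
  qed
  then show ?thesis by (rule that)
qed

end

end

section \<open>Comparison of complexities\<close>

lemma topspace_hull:
  "flc_tiling Pr T \<Longrightarrow> topspace (space_topology (tiling_hull Pr T)) = tiling_hull Pr T"
  unfolding space_topology_def
  by (rule Metric_space.topspace_mtopology[OF flc_tiling.hull_metric])

lemma tiling_map_of_continuous_map:
  assumes flc: "flc_tiling Pr T" "flc_tiling Pr' T'"
    and h: "continuous_map (space_topology (tiling_hull Pr T)) (space_topology (tiling_hull Pr' T')) h"
  shows "tiling_map (tiling_hull Pr T) (tiling_hull Pr' T') h"
proof
  fix S x assume S: "S \<in> tiling_hull Pr T"
  show "S \<ominus> x \<in> tiling_hull Pr T" by (rule flc_tiling.hull_invariant[OF flc(1) S])
  show "h S \<in> tiling_hull Pr' T'"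
    using continuous_map_image_subset_topspace[OF h] S
    unfolding topspace_hull[OF flc(1)] topspace_hull[OF flc(2)] by blast
next
  fix S x assume S: "S \<in> tiling_hull Pr' T'"
  show "S \<ominus> x \<in> tiling_hull Pr' T'" by (rule flc_tiling.hull_invariant[OF flc(2) S])
  show "fst t \<noteq> {}" if "t \<in> S" for t
    by (rule flc_tiling.hull_nonempty_tiles[OF flc(2) S that])
next
  show "patch_continuous (tiling_hull Pr T) h"
    by (rule continuous_map_imp_patch_continuous[OF flc h])
  interpret B: flc_tiling Pr' T' by (rule flc(2))
  show "rigid (tiling_hull Pr' T')" by (rule B.tilings_rigid[OF B.hull_subset])
qed

lemma tiling_equivalence_of_homeomorphism:
  assumes flc: "flc_tiling Pr T" "flc_tiling Pr' T'"
    and hom: "homeomorphic_maps (space_topology (tiling_hull Pr T)) (space_topology (tiling_hull Pr' T')) h g"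
  shows "tiling_equivalence (tiling_hull Pr T) (tiling_hull Pr' T') h g"
  using tiling_map_of_continuous_map[OF flc, of h] tiling_map_of_continuous_map[OF flc(2,1), of g] hom
  unfolding homeomorphic_maps_def topspace_hull[OF flc(1)] topspace_hull[OF flc(2)]
  by (intro tiling_equivalence.intro tiling_equivalence_axioms.intro) auto

text \<open>Each tiling of the second transversal is moved by a bounded translation to the image of
  a tiling of the first. When two of them come from the same patch of the first, they agree on
  the smaller ball up to a bounded translation which, by locality, goes from one point of the
  pattern to another; only boundedly many translations do that.\<close>

lemma complexity_comparison:
  fixes Pr :: "('a::euclidean_space, 'l) tile set set" and Pr' :: "('a, 'm) tile set set"
  assumes flc: "flc_tiling Pr T" "flc_tiling Pr' T'"
    and hom: "homeomorphic_maps (space_topology (tiling_hull Pr T)) (space_topology (tiling_hull Pr' T')) h g"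
    and rule: "local_pointing_rule (tiling_hull Pr T) \<D>"
    and rule': "local_pointing_rule (tiling_hull Pr' T') \<D>'"
  defines "\<Xi> \<equiv> canonical_transversal (tiling_hull Pr T) \<D>"
    and "\<Xi>' \<equiv> canonical_transversal (tiling_hull Pr' T') \<D>'"
  obtains C M where "C > 0" "M > 0"
    "\<And>r. r \<ge> 0 \<Longrightarrow> finite {patch S 0 (C * (r + 1)) | S. S \<in> \<Xi>} \<Longrightarrow>
      finite {patch S 0 r | S. S \<in> \<Xi>'} \<and> complexity \<Xi>' r \<le> M * complexity \<Xi> (C * (r + 1))"
proof -
  let ?A = "tiling_hull Pr T" and ?B = "tiling_hull Pr' T'"
  interpret A: flc_tiling Pr T by (rule flc(1))
  interpret B: flc_tiling Pr' T' by (rule flc(2))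
  interpret E: tiling_equivalence ?A ?B h g
    by (rule tiling_equivalence_of_homeomorphism[OF flc hom])
  obtain R\<^sub>1 where R1: "R\<^sub>1 > 0" "\<And>S. S \<in> ?A \<Longrightarrow> \<exists>p\<in>\<D> S. norm p \<le> R\<^sub>1"
    by (rule A.points_uniformly_dense[OF rule]) blast
  obtain C\<^sub>1 where C1: "C\<^sub>1 > 0"
    "\<And>S x. S \<in> ?A \<Longrightarrow> \<exists>z. norm z \<le> C\<^sub>1 * (norm x + 1) \<and> h (S \<ominus> x) = h S \<ominus> z"
    by (rule E.forward.linear_displacement) blast
  define c where "c = C\<^sub>1 * (R\<^sub>1 + 1)"
  have c: "c > 0" using C1(1) R1(1) by (simp add: c_def)
  obtain R where R: "R > 0"
    "\<And>S\<^sub>1 S\<^sub>2 r p. S\<^sub>1 \<in> ?B \<Longrightarrow> S\<^sub>2 \<in> ?B \<Longrightarrow> agree S\<^sub>1 S\<^sub>2 (r + R) \<Longrightarrow> norm p \<le> r \<Longrightarrow>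
      p \<in> \<D>' S\<^sub>1 \<longleftrightarrow> p \<in> \<D>' S\<^sub>2"
    by (rule B.points_local[OF rule']) blast
  obtain M where M: "\<And>S. S \<in> ?B \<Longrightarrow>
      finite {p \<in> \<D>' S. norm p \<le> 2 * c + 1} \<and> card {p \<in> \<D>' S. norm p \<le> 2 * c + 1} \<le> M"
    by (rule B.points_uniformly_few[OF rule']) blast
  obtain C\<^sub>0 where C0: "C\<^sub>0 > 0"
    "\<And>S\<^sub>1 S\<^sub>2 r. S\<^sub>1 \<in> ?A \<Longrightarrow> S\<^sub>2 \<in> ?A \<Longrightarrow> r \<ge> 0 \<Longrightarrow> agree S\<^sub>1 S\<^sub>2 (C\<^sub>0 * (r + 1)) \<Longrightarrow>
      \<exists>y. norm y < 1 \<and> agree (h S\<^sub>1) (h S\<^sub>2 \<ominus> y) r"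
    by (rule E.agree_transfer) blast
  \<comment> \<open>Images are to agree on a ball of radius \<open>r + (c + R + 2)\<close>: moving back by a vector of
    norm at most \<open>c + 1\<close> must leave the radius \<open>r + R\<close>, where \<open>R\<close> serves to compare the
    patterns.\<close>
  define C where "C = C\<^sub>0 * (c + R + 3)"
  have C: "C > 0" using C0(1) c R(1) by (simp add: C_def)
  have "\<forall>S\<in>\<Xi>'. \<exists>v. fst v \<in> \<Xi> \<and> norm (snd v) \<le> c \<and> h (fst v) = S \<ominus> snd v"
  proof
    fix S assume "S \<in> \<Xi>'"
    then have S: "S \<in> ?B" by (simp add: \<Xi>'_def canonical_transversal_def)
    then have gS: "g S \<in> ?A" by (rule E.backward.maps)
    obtain p where p: "p \<in> \<D> (g S)" "norm p \<le> R\<^sub>1" using R1(2)[OF gS] by blast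
    obtain z where z: "norm z \<le> C\<^sub>1 * (norm p + 1)" "h (g S \<ominus> p) = h (g S) \<ominus> z"
      using C1(2)[OF gS] by blast
    have "C\<^sub>1 * (norm p + 1) \<le> c" unfolding c_def using p(2) C1(1) by simp
    moreover have "g S \<ominus> p \<in> \<Xi>"
      using A.point_iff_origin[OF rule gS] p(1) A.hull_invariant[OF gS]
      by (simp add: \<Xi>_def canonical_transversal_def)
    ultimately show "\<exists>v. fst v \<in> \<Xi> \<and> norm (snd v) \<le> c \<and> h (fst v) = S \<ominus> snd v"
      using z E.right_inverse[OF S] by (intro exI[of _ "(g S \<ominus> p, z)"]) auto
  qed
  from bchoice[OF this] obtain v where
    v: "\<forall>S\<in>\<Xi>'. fst (v S) \<in> \<Xi> \<and> norm (snd (v S)) \<le> c \<and> h (fst (v S)) = S \<ominus> snd (v S)" ..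
  define U where "U S = fst (v S)" for S
  define z where "z S = snd (v S)" for S
  have U: "U S \<in> \<Xi>" "norm (z S) \<le> c" "h (U S) = S \<ominus> z S" if "S \<in> \<Xi>'" for S
    using v that by (auto simp: U_def z_def)
  have close: "\<exists>w\<in>{p \<in> \<D>' S. norm p \<le> 2 * c + 1}. patch S' 0 r = patch (S \<ominus> w) 0 r"
    if S: "S \<in> \<Xi>'" "S' \<in> \<Xi>'" and r: "r \<ge> 0"
      and ag: "agree (U S) (U S') (C * (r + 1))" for S S' r
  proof -
    have hull: "S \<in> ?B" "S' \<in> ?B" "U S \<in> ?A" "U S' \<in> ?A" "0 \<in> \<D>' S'"
      using S U(1)[OF S(1)] U(1)[OF S(2)]
      by (simp_all add: \<Xi>_def \<Xi>'_def canonical_transversal_def)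
    have "C\<^sub>0 * ((r + (c + R + 2)) + 1) \<le> C * (r + 1)"
    proof -
      have "0 \<le> C\<^sub>0 * (r * (c + R + 2))" using C0(1) r c R(1) by simp
      then show ?thesis unfolding C_def by (simp add: algebra_simps)
    qed
    then obtain y where y: "norm y < 1" "agree (h (U S)) (h (U S') \<ominus> y) (r + (c + R + 2))"
      using C0(2)[OF hull(3,4), of "r + (c + R + 2)"] agree_mono[OF ag] r c R(1) by auto
    \<comment> \<open>The pattern of \<open>S'\<close> contains the origin and agrees near it with that of \<open>S\<close> moved by
      \<open>w\<close>; hence \<open>w\<close> is a point of the pattern of \<open>S\<close>.\<close>
    define w where "w = z S - z S' - y"
    have nw: "norm w \<le> 2 * c + 1"
      using norm_triangle_ineq4[of "z S - z S'" y] norm_triangle_ineq4[of "z S" "z S'"]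
        U(2)[OF S(1)] U(2)[OF S(2)] y(1) unfolding w_def by linarith
    have "norm (- (z S' + y)) \<le> c + 1"
      using norm_triangle_ineq[of "z S'" y] U(2)[OF S(2)] y(1) unfolding norm_minus_cancel by linarith
    then have "agree (h (U S) \<ominus> - (z S' + y)) (h (U S') \<ominus> y \<ominus> - (z S' + y)) (r + R)"
      by (intro agree_shift[OF y(2)]) linarith
    then have ag': "agree (S \<ominus> w) S' (r + R)"
      unfolding U(3)[OF S(1)] U(3)[OF S(2)] tiling_minus_minus w_def by (simp add: algebra_simps)
    have "0 \<in> \<D>' (S \<ominus> w)"
      using R(2)[OF B.hull_invariant[OF hull(1)] hull(2) ag', of 0] hull(5) r by simp
    then have "w \<in> \<D>' S" using B.point_iff_origin[OF rule' hull(1)] by simp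
    moreover have "patch S' 0 r = patch (S \<ominus> w) 0 r"
      using agree_mono[OF ag', of r] R(1) by (simp add: agree_def)
    ultimately show ?thesis using nw by blast
  qed
  have main: "finite {patch S 0 r | S. S \<in> \<Xi>'} \<and>
      complexity \<Xi>' r \<le> Suc M * complexity \<Xi> (C * (r + 1))"
    if r: "r \<ge> 0" and fin: "finite {patch S 0 (C * (r + 1)) | S. S \<in> \<Xi>}" for r
  proof -
    define P where "P = {patch S 0 (C * (r + 1)) | S. S \<in> \<Xi>}"
    define Q where "Q q = {patch S 0 r | S. S \<in> \<Xi>' \<and> patch (U S) 0 (C * (r + 1)) = q}" for q
    have Q: "finite (Q q) \<and> card (Q q) \<le> Suc M" for q
    proof (cases "Q q = {}")
      case False
      then obtain S where S: "S \<in> \<Xi>'" "patch (U S) 0 (C * (r + 1)) = q"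
        by (auto simp: Q_def)
      let ?W = "{p \<in> \<D>' S. norm p \<le> 2 * c + 1}"
      have sub: "Q q \<subseteq> (\<lambda>w. patch (S \<ominus> w) 0 r) ` ?W"
      proof
        fix a assume "a \<in> Q q"
        then obtain S' where S': "S' \<in> \<Xi>'" "patch (U S') 0 (C * (r + 1)) = q" "a = patch S' 0 r"
          by (auto simp: Q_def)
        then have "agree (U S) (U S') (C * (r + 1))" using S(2) by (simp add: agree_def)
        from close[OF S(1) S'(1) r this] show "a \<in> (\<lambda>w. patch (S \<ominus> w) 0 r) ` ?W"
          unfolding S'(3) by (elim bexE) (rule image_eqI)
      qed
      have W: "finite ?W" "card ?W \<le> M"
        using M S(1) by (simp_all add: \<Xi>'_def canonical_transversal_def)
      have "finite (Q q)" using sub W(1) by (meson finite_imageI finite_subset)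
      moreover have "card (Q q) \<le> card ?W" by (rule surj_card_le[OF W(1) sub])
      ultimately show ?thesis using W(2) by simp
    qed simp
    have eq: "{patch S 0 r | S. S \<in> \<Xi>'} = (\<Union>q\<in>P. Q q)"
      using U(1) unfolding P_def Q_def by blast
    have P: "finite P" using fin by (simp add: P_def)
    have "card (\<Union>q\<in>P. Q q) \<le> (\<Sum>q\<in>P. card (Q q))" by (rule card_UN_le[OF P])
    also have "\<dots> \<le> (\<Sum>q\<in>P. Suc M)" by (intro sum_mono) (use Q in blast)
    finally have "card (\<Union>q\<in>P. Q q) \<le> Suc M * card P" by (simp add: mult.commute)
    then show ?thesis unfolding complexity_def eq using P Q by (simp add: P_def)
  qed
  show ?thesis by (rule that[OF C _ main]) simp
qed

section \<open>Polynomial growth\<close>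

text \<open>The minimum and the maximum cover both signs of the exponent.\<close>

lemma powr_between:
  fixes a b r s \<alpha> :: real
  assumes "0 < a" "0 < s" "a * s \<le> r" "r \<le> b * s"
  shows "min (a powr \<alpha>) (b powr \<alpha>) * s powr \<alpha> \<le> r powr \<alpha>"
    and "r powr \<alpha> \<le> max (a powr \<alpha>) (b powr \<alpha>) * s powr \<alpha>"
proof -
  have as: "0 < a * s" using assms by simp
  have "a * s \<le> b * s" using assms by linarith
  then have b: "0 < b" using assms(1,2) by simp
  have lo: "min (a powr \<alpha>) (b powr \<alpha>) * s powr \<alpha> \<le> min ((a * s) powr \<alpha>) ((b * s) powr \<alpha>)"
    using assms(1,2) b by (auto simp: powr_mult intro!: mult_right_mono)
  have hi: "max ((a * s) powr \<alpha>) ((b * s) powr \<alpha>) \<le> max (a powr \<alpha>) (b powr \<alpha>) * s powr \<alpha>"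
    using assms(1,2) b by (auto simp: powr_mult intro!: mult_right_mono)
  have "min ((a * s) powr \<alpha>) ((b * s) powr \<alpha>) \<le> r powr \<alpha> \<and>
      r powr \<alpha> \<le> max ((a * s) powr \<alpha>) ((b * s) powr \<alpha>)"
  proof (cases "\<alpha> \<ge> 0")
    case True
    then have "(a * s) powr \<alpha> \<le> r powr \<alpha>" "r powr \<alpha> \<le> (b * s) powr \<alpha>"
      using assms(3,4) as by (auto intro!: powr_mono2)
    then show ?thesis by linarith
  next
    case False
    then have "r powr \<alpha> \<le> (a * s) powr \<alpha>" "(b * s) powr \<alpha> \<le> r powr \<alpha>"
      using assms(3,4) as by (auto intro!: powr_mono2')
    then show ?thesis by linarith
  qed
  then show "min (a powr \<alpha>) (b powr \<alpha>) * s powr \<alpha> \<le> r powr \<alpha>"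
    and "r powr \<alpha> \<le> max (a powr \<alpha>) (b powr \<alpha>) * s powr \<alpha>"
    using lo hi by linarith+
qed

lemma polynomial_growth_transfer:
  assumes p: "polynomial_growth p \<alpha>"
    and C: "C > 0" and M: "M > 0" and C': "C' > 0" and M': "M' > 0"
    and le: "\<forall>\<^sub>F r in at_top. q r \<le> M * p (C * (r + 1))"
    and ge: "\<forall>\<^sub>F r in at_top. p r \<le> M' * q (C' * (r + 1))"
  shows "polynomial_growth q \<alpha>"
proof -
  obtain C\<^sub>1 C\<^sub>2 N where C12: "C\<^sub>1 > 0" "C\<^sub>2 > 0"
    and N: "\<And>r. r \<ge> N \<Longrightarrow> C\<^sub>1 * r powr \<alpha> \<le> real (p r) \<and> real (p r) \<le> C\<^sub>2 * r powr \<alpha>"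
    using p unfolding polynomial_growth_def eventually_at_top_linorder by blast
  obtain L where L: "\<And>r. r \<ge> L \<Longrightarrow> q r \<le> M * p (C * (r + 1))"
    using le unfolding eventually_at_top_linorder by blast
  obtain L' where L': "\<And>r. r \<ge> L' \<Longrightarrow> p r \<le> M' * q (C' * (r + 1))"
    using ge unfolding eventually_at_top_linorder by blast
  define u where "u = max (C powr \<alpha>) ((2 * C) powr \<alpha>)"
  define l where "l = min ((1 / (2 * C')) powr \<alpha>) ((1 / C') powr \<alpha>)"
  have ul: "u > 0" "l > 0" using C C' by (auto simp: u_def l_def max_def min_def)
  define B where "B = Max {1, L, N / C, 2 * C', C' * (N + 1), C' * (L' + 1)}"
  have "C\<^sub>1 * l / real M' * s powr \<alpha> \<le> real (q s) \<and> real (q s) \<le> real M * C\<^sub>2 * u * s powr \<alpha>"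
    if "s \<ge> B" for s
  proof
    have s: "s \<ge> 1" "s \<ge> L" "s \<ge> N / C" "s \<ge> 2 * C'" "s \<ge> C' * (N + 1)" "s \<ge> C' * (L' + 1)"
      using that by (auto simp: B_def)
    have "N \<le> C * (s + 1)" using s(3) C by (simp add: field_simps)
    then have "real (p (C * (s + 1))) \<le> C\<^sub>2 * (C * (s + 1)) powr \<alpha>" using N by blast
    also have "(C * (s + 1)) powr \<alpha> \<le> u * s powr \<alpha>"
      unfolding u_def using C s(1) by (intro powr_between(2)) (auto simp: algebra_simps)
    finally have "real (p (C * (s + 1))) \<le> C\<^sub>2 * (u * s powr \<alpha>)" using C12(2) by simp
    moreover have "real (q s) \<le> real M * real (p (C * (s + 1)))"
      using L[OF s(2)] by (metis of_nat_le_iff of_nat_mult)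
    moreover have "real M * real (p (C * (s + 1))) \<le> real M * (C\<^sub>2 * (u * s powr \<alpha>))"
      using calculation(1) by (intro mult_left_mono) auto
    ultimately show "real (q s) \<le> real M * C\<^sub>2 * u * s powr \<alpha>" by (simp add: mult.assoc)
    \<comment> \<open>The lower bound at \<open>s\<close> comes from that of \<open>p\<close> at the radius \<open>r\<close> with
      \<open>C' * (r + 1) = s\<close>.\<close>
    define r where "r = s / C' - 1"
    have sr: "C' * (r + 1) = s" using C' by (simp add: r_def field_simps)
    have r: "r \<ge> N" "r \<ge> L'" using s(5,6) C' by (auto simp: r_def field_simps)
    have "l * s powr \<alpha> \<le> r powr \<alpha>"
      unfolding l_def using C' s(1,4) by (intro powr_between(1)) (auto simp: r_def field_simps)
    then have "C\<^sub>1 * (l * s powr \<alpha>) \<le> C\<^sub>1 * r powr \<alpha>" using C12(1) by simp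
    also have "\<dots> \<le> real (p r)" using N[OF r(1)] by blast
    also have "\<dots> \<le> real M' * real (q s)"
      using L'[OF r(2)] unfolding sr by (metis of_nat_le_iff of_nat_mult)
    finally show "C\<^sub>1 * l / real M' * s powr \<alpha> \<le> real (q s)"
      using M' by (simp add: field_simps)
  qed
  then have "\<forall>\<^sub>F s in at_top. C\<^sub>1 * l / real M' * s powr \<alpha> \<le> real (q s) \<and>
      real (q s) \<le> real M * C\<^sub>2 * u * s powr \<alpha>"
    unfolding eventually_at_top_linorder by blast
  moreover have "C\<^sub>1 * l / real M' > 0" "real M * C\<^sub>2 * u > 0" using C12 ul M M' by auto
  ultimately show ?thesis unfolding polynomial_growth_def by blast
qed

text \<open>Both directions of the comparison require finite sets of patches. For the first
  transversal they are finite at large radii because their cardinality, which would be \<open>0\<close>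
  for an infinite set, is bounded below by a positive number; the first comparison then gives
  finiteness for the second transversal, which the reverse comparison requires.\<close>

lemma polynomial_growth_homeomorphism:
  fixes Pr :: "('a::euclidean_space, 'l) tile set set" and Pr' :: "('a, 'm) tile set set"
  assumes flc: "flc_tiling Pr T" "flc_tiling Pr' T'"
    and hom: "homeomorphic_maps (space_topology (tiling_hull Pr T)) (space_topology (tiling_hull Pr' T')) h g"
    and rule: "local_pointing_rule (tiling_hull Pr T) \<D>"
    and rule': "local_pointing_rule (tiling_hull Pr' T') \<D>'"
    and growth: "polynomial_growth (complexity (canonical_transversal (tiling_hull Pr T) \<D>)) \<alpha>"
  shows "polynomial_growth (complexity (canonical_transversal (tiling_hull Pr' T') \<D>')) \<alpha>"
proof -
  define \<Xi> where "\<Xi> = canonical_transversal (tiling_hull Pr T) \<D>"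
  define \<Xi>' where "\<Xi>' = canonical_transversal (tiling_hull Pr' T') \<D>'"
  obtain C M where C: "C > 0" "M > 0"
    "\<And>r. r \<ge> 0 \<Longrightarrow> finite {patch S 0 (C * (r + 1)) | S. S \<in> \<Xi>} \<Longrightarrow>
      finite {patch S 0 r | S. S \<in> \<Xi>'} \<and> complexity \<Xi>' r \<le> M * complexity \<Xi> (C * (r + 1))"
    unfolding \<Xi>_def \<Xi>'_def by (rule complexity_comparison[OF flc hom rule rule']) blast
  have hom': "homeomorphic_maps (space_topology (tiling_hull Pr' T')) (space_topology (tiling_hull Pr T)) g h"
    using hom homeomorphic_maps_sym by blast
  obtain C' M' where C': "C' > 0" "M' > 0"
    "\<And>r. r \<ge> 0 \<Longrightarrow> finite {patch S 0 (C' * (r + 1)) | S. S \<in> \<Xi>'} \<Longrightarrow>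
      finite {patch S 0 r | S. S \<in> \<Xi>} \<and> complexity \<Xi> r \<le> M' * complexity \<Xi>' (C' * (r + 1))"
    unfolding \<Xi>_def \<Xi>'_def by (rule complexity_comparison[OF flc(2,1) hom' rule' rule]) blast
  obtain C\<^sub>1 N where N: "C\<^sub>1 > 0" "\<And>r. r \<ge> N \<Longrightarrow> C\<^sub>1 * r powr \<alpha> \<le> real (complexity \<Xi> r)"
    using growth unfolding polynomial_growth_def eventually_at_top_linorder \<Xi>_def by blast
  have fin: "finite {patch S 0 r | S. S \<in> \<Xi>}" if "r \<ge> max 1 N" for r
  proof (rule ccontr)
    assume "infinite {patch S 0 r | S. S \<in> \<Xi>}"
    then have "complexity \<Xi> r = 0" by (simp add: complexity_def)
    moreover have "0 < C\<^sub>1 * r powr \<alpha>" using N(1) that by simp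
    ultimately show False using N(2)[of r] that by simp
  qed
  define B where "B = max 0 (max 1 N / C)"
  have B: "finite {patch S 0 r | S. S \<in> \<Xi>'} \<and> complexity \<Xi>' r \<le> M * complexity \<Xi> (C * (r + 1))"
    if "r \<ge> B" for r
  proof (rule C(3))
    have "max 1 N / C \<le> r" using that by (simp add: B_def)
    then have "max 1 N \<le> C * (r + 1)" using C(1) by (simp add: pos_divide_le_eq algebra_simps)
    then show "finite {patch S 0 (C * (r + 1)) | S. S \<in> \<Xi>}" by (rule fin)
  qed (use that in \<open>simp add: B_def\<close>)
  have B': "complexity \<Xi> r \<le> M' * complexity \<Xi>' (C' * (r + 1))" if "r \<ge> max 0 (B / C')" for r
  proof -
    have "B / C' \<le> r" using that by simp
    then have "B \<le> C' * (r + 1)" using C'(1) by (simp add: pos_divide_le_eq algebra_simps)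
    then show ?thesis using C'(3)[of r] B that by simp
  qed
  have "polynomial_growth (complexity \<Xi>') \<alpha>"
  proof (rule polynomial_growth_transfer[OF _ C(1,2) C'(1,2)])
    show "polynomial_growth (complexity \<Xi>) \<alpha>" using growth by (simp add: \<Xi>_def)
    show "\<forall>\<^sub>F r in at_top. complexity \<Xi>' r \<le> M * complexity \<Xi> (C * (r + 1))"
      using B unfolding eventually_at_top_linorder by blast
    show "\<forall>\<^sub>F r in at_top. complexity \<Xi> r \<le> M' * complexity \<Xi>' (C' * (r + 1))"
      using B' unfolding eventually_at_top_linorder by blast
  qed
  then show ?thesis by (simp add: \<Xi>'_def)
qed

lemma space_is_hull:
  assumes "aperiodic_repetitive_FLC_space \<Omega>"
  shows "\<exists>Pr T. flc_tiling Pr T \<and> \<Omega> = tiling_hull Pr T"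
  using assms unfolding aperiodic_repetitive_FLC_space_def
    flc_tiling_def flc_tiling_axioms_def finite_prototiles_def by blast

theorem corollary3p2:
  fixes \<Omega> :: "('a::euclidean_space, 'l) tiling set"
    and \<alpha> :: real
  assumes "aperiodic_repetitive_FLC_space \<Omega>"
    and "polynomial_complexity \<Omega> \<alpha>"
  shows "(\<forall>\<D>. local_pointing_rule \<Omega> \<D> \<longrightarrow>
            polynomial_growth (complexity (canonical_transversal \<Omega> \<D>)) \<alpha>) \<and>
         (\<forall>\<Omega>' :: ('a, 'm) tiling set.
            aperiodic_repetitive_FLC_space \<Omega>' \<and>
            space_topology \<Omega>' homeomorphic_space space_topology \<Omega> \<longrightarrow>
            polynomial_complexity \<Omega>' \<alpha>)"
proof (intro conjI allI impI)
  obtain Pr T where hull: "flc_tiling Pr T" and \<Omega>: "\<Omega> = tiling_hull Pr T"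
    using space_is_hull[OF assms(1)] by blast
  obtain \<D> where \<D>: "local_pointing_rule \<Omega> \<D>"
    "polynomial_growth (complexity (canonical_transversal \<Omega> \<D>)) \<alpha>"
    using assms(2) unfolding polynomial_complexity_def by blast
  show "polynomial_growth (complexity (canonical_transversal \<Omega> \<D>')) \<alpha>"
    if "local_pointing_rule \<Omega> \<D>'" for \<D>'
    using polynomial_growth_homeomorphism[OF hull hull _ _ _ \<D>(2)[unfolded \<Omega>], of "\<lambda>S. S" "\<lambda>S. S" \<D>']
      \<D>(1) that homeomorphic_maps_id[of "space_topology (tiling_hull Pr T)"
        "space_topology (tiling_hull Pr T)"]
    unfolding \<Omega> id_def by simp
  fix \<Omega>' :: "('a, 'm) tiling set"
  assume \<Omega>': "aperiodic_repetitive_FLC_space \<Omega>' \<and>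
    space_topology \<Omega>' homeomorphic_space space_topology \<Omega>"
  obtain Pr' T' where hull': "flc_tiling Pr' T'" and \<Omega>'_eq: "\<Omega>' = tiling_hull Pr' T'"
    using space_is_hull \<Omega>' by blast
  obtain h g where hom: "homeomorphic_maps (space_topology \<Omega>) (space_topology \<Omega>') h g"
    using \<Omega>' homeomorphic_space_sym unfolding homeomorphic_space_def by blast
  interpret B: flc_tiling Pr' T' by (rule hull')
  obtain \<D>' where \<D>': "local_pointing_rule \<Omega>' \<D>'"
    using B.pointing_rule_exists[OF B.hull_subset] unfolding \<Omega>'_eq by blast
  have "polynomial_growth (complexity (canonical_transversal \<Omega>' \<D>')) \<alpha>"
    unfolding \<Omega>'_eq
    by (rule polynomial_growth_homeomorphism[OF hull hull'])
      (use hom \<D> \<D>' \<Omega> \<Omega>'_eq in simp_all)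
  then show "polynomial_complexity \<Omega>' \<alpha>"
    unfolding polynomial_complexity_def using \<D>' by blast
qed

end
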